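(* Let $u\in V(\mathcal T_h)$ be the unique solution of $a(u,v)=L(v)$ for all $v\in V(\mathcal T_h)$. Let $i\ge1$, let $\epsilon_1,\dots,\epsilon_i\in(0,1)$, and let $u_0,u_1,\dots,u_i$ and $\varphi_1^{NN},\dots,\varphi_i^{NN}$ be generated by the recursive discontinuous Galerkin plane wave neural network procedure described in the context. Assume that $|||u-u_{j-1}|||>0$ for $j=1,\dots,i$, and that for each $j=1,\dots,i$ the integer $n_j=n(\epsilon_j,u_{j-1})\in\mathbb N$ and the function $\varphi_j^{NN}\in V_{n_j}^\sigma(\mathcal T_h)\cap B$ are such that $\varphi_j^{NN}$ is a quasi-maximizer of $\langle r(u_{j-1}),\cdot\rangle$ associated with $\epsilon_j$ and $$\Big|\Big|\Big|\varphi_j^{NN}-\frac{u-u_{j-1}}{|||u-u_{j-1}|||}\Big|\Big|\Big|\le\epsilon_j .$$ Then $$|||u-u_i|||<|||u-u_0|||\prod_{j=1}^i\epsilon_j .$$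
   Context: Helmholtz setting. $\Omega\subset\mathbb R^d$ ($d=2,3$) is a bounded polygonal/polyhedral domain with boundary $\gamma$, $\omega>0$, $g\in L^2(\gamma)$; the underlying problem is $-\Delta u-\omega^2u=0$ in $\Omega$, $(\partial_{\mathbf n}+\mathrm i\omega)u=g$ on $\gamma$. $\mathcal T_h=\{\Omega_1,\dots,\Omega_N\}$ is a finite element partition of $\Omega$ (hanging nodes allowed), $\Gamma_{kj}=\partial\Omega_k\cap\partial\Omega_j$ for $k\ne j$, $\gamma_k=\overline\Omega_k\cap\partial\Omega$, and $\mathbf n_k$ is the outward unit normal to $\Omega_k$. $V(\Omega_k)=\{v_k\in H^1(\Omega_k): -\Delta v_k-\omega^2v_k=0\}$ and $V(\mathcal T_h)=\{v\in L^2(\Omega): v|_{\Omega_k}\in V(\Omega_k)\ \forall k\}$, with $v_k=v|_{\Omega_k}$; functions are understood to have square-integrable traces and normal derivatives on the element boundaries, so that the forms below are finite. For fixed positive parameters $\alpha,\beta$, $$a(u,v)=\sum_{k=1}^N\int_{\gamma_k}(\partial_{\mathbf n}+\mathrm i\omega)u_k\,\overline{(\partial_{\mathbf n}+\mathrm i\omega)v_k}\,ds+\sum_{j\ne k}\Big(\alpha\int_{\Gamma_{kj}}(u_k-u_j)\overline{(v_k-v_j)}\,ds+\beta\int_{\Gamma_{kj}}(\partial_{\mathbf n_k}u_k+\partial_{\mathbf n_j}u_j)\overline{(\partial_{\mathbf n_k}v_k+\partial_{\mathbf n_j}v_j)}\,ds\Big),$$ $$L(v)=\sum_{k=1}^N\int_{\gamma_k}g\,\overline{(\partial_{\mathbf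 n}+\mathrm i\omega)v_k}\,ds .$$ $|||v|||=a(v,v)^{1/2}$ is a norm on $V(\mathcal T_h)$; $B$ is the closed unit ball of $V(\mathcal T_h)$ in this norm. The variational problem $a(u,v)=L(v)$ for all $v\in V(\mathcal T_h)$ has a unique solution $u\in V(\mathcal T_h)$. Discontinuous plane wave neural network set of width $n$: $$V_n^\sigma(\mathcal T_h)=\Big\{v: v|_{\Omega_k}(x)=\sum_{j=1}^nc_j^{(k)}e^{\mathrm i\omega W_j^{(k)}\cdot x},\ c_j^{(k)}\in\mathbb C,\ W_j^{(k)}\in\mathbb R^d,\ |W_j^{(k)}|=1,\ \forall\,\Omega_k\in\mathcal T_h\Big\}.$$ Residual functional: $\langle r(w),v\rangle=\mathrm{Re}\{L(v)-a(w,v)\}=\mathrm{Re}\{a(u-w,v)\}$ for $w,v\in V(\mathcal T_h)$. Quasi-maximizer: $\varphi_j^{NN}\in V_{n_j}^\sigma(\mathcal T_h)\cap B$ is a quasi-maximizer of $\langle r(u_{j-1}),\cdot\rangle$ associated with $\epsilon_j$ if $$\langle r(u_{j-1}),\varphi_j^{NN}\rangle\ge\sup_{v\in V_{n_j}^\sigma(\mathcal T_h)\cap B}\langle r(u_{j-1}),v\rangle-\epsilon_j|||u-u_{j-1}|||.$$ Recursive procedure: $u_0=0$. Given $u_{j-1}$, a quasi-maximizer $\varphi_j^{NN}$ of $\langle r(u_{j-1}),\cdot\rangle$, normalized so that $|||\varphi_j^{NN}|||=1$, is chosen; put $\Phi_j^{NN}=\mathrm{span}\{\varphi_1^{NN},\dots,\varphi_j^{NN}\}$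 (complex span), and let $u_j\in\Phi_j^{NN}$ be the Galerkin solution: $a(u_j,v)=L(v)$ for all $v\in\Phi_j^{NN}$. *)

theory Defs
  imports "HOL-Analysis.Analysis"
begin

section \<open>Surface measure\<close>

text \<open>
  The \<open>s\<close>-dimensional Hausdorff outer measure, for \<open>s \<ge> 1\<close>, normalised so that it agrees with
  Lebesgue measure on \<open>s\<close>-dimensional planes. (The \<open>diameter\<close> of an unbounded set is a junk
  value, hence the explicit boundedness of the covering sets.)
\<close>

definition hausdorff_outer :: "nat \<Rightarrow> 'a::euclidean_space set \<Rightarrow> ennreal" where
  "hausdorff_outer s A =
     (SUP \<delta>\<in>{0::real<..}.
        INF U\<in>{U :: nat \<Rightarrow> 'a set. A \<subseteq> (\<Union>i. U i) \<and> (\<forall>i. bounded (U i) \<and> diameter (U i) \<le> \<delta>)}.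
          \<Sum>i. ennreal (unit_ball_vol (real s) * (diameter (U i) / 2) ^ s))"

text \<open>
  A Hausdorff outer measure is a metric outer measure, hence countably additive on the Borel
  sets by Caratheodory's criterion, so \<open>measure_of\<close> does not degenerate here. The measure is
  completed, as \<open>lebesgue\<close> is, so that almost-everywhere modifications stay measurable.
\<close>

definition surface_on :: "'a::euclidean_space set \<Rightarrow> 'a measure" where
  "surface_on \<Gamma> =
     restrict_space (completion (measure_of UNIV (sets borel) (hausdorff_outer (DIM('a) - 1)))) \<Gamma>"

definition square_integrable :: "'a measure \<Rightarrow> ('a \<Rightarrow> complex) \<Rightarrow> bool" where
  "square_integrable M f \<longleftrightarrow> f \<in> borel_measurable M \<and> integrable M (\<lambda>x. (cmod (f x))\<^sup>2)"


section \<open>Sobolev functions, traces and normal derivatives\<close>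

text \<open>
  All notions below depend only on the values of the function on the open set \<open>D\<close> (up to null
  sets), so no explicit restriction of functions to \<open>D\<close> is needed.
\<close>

abbreviation partial_deriv :: "'a::euclidean_space \<Rightarrow> ('a \<Rightarrow> real) \<Rightarrow> 'a \<Rightarrow> real" where
  "partial_deriv b \<phi> x \<equiv> frechet_derivative \<phi> (at x) b"

definition C1_fun :: "('a::euclidean_space \<Rightarrow> real) \<Rightarrow> bool" where
  "C1_fun \<phi> \<longleftrightarrow>
     (\<forall>x. \<phi> differentiable (at x)) \<and> (\<forall>b\<in>Basis. continuous_on UNIV (partial_deriv b \<phi>))"

definition test_fun :: "'a::euclidean_space set \<Rightarrow> ('a \<Rightarrow> real) \<Rightarrow> bool" where
  "test_fun D \<phi> \<longleftrightarrow>
     C1_fun \<phi> \<and> compact (closure {x. \<phi> x \<noteq> 0}) \<and> closure {x. \<phi> x \<noteq> 0} \<subseteq> D"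

text \<open>\<open>G b\<close> is the weak partial derivative of \<open>v\<close> in the coordinate direction \<open>b\<close>.\<close>

definition weak_gradient ::
  "'a::euclidean_space set \<Rightarrow> ('a \<Rightarrow> complex) \<Rightarrow> ('a \<Rightarrow> 'a \<Rightarrow> complex) \<Rightarrow> bool" where
  "weak_gradient D v G \<longleftrightarrow>
     (\<forall>b\<in>Basis. square_integrable (lebesgue_on D) (G b) \<and>
        (\<forall>\<phi>. test_fun D \<phi> \<longrightarrow>
          (LINT x|lebesgue_on D. partial_deriv b \<phi> x *\<^sub>R v x) =
          - (LINT x|lebesgue_on D. \<phi> x *\<^sub>R G b x)))"

definition H1 :: "'a::euclidean_space set \<Rightarrow> ('a \<Rightarrow> complex) set" where
  "H1 D = {v. square_integrable (lebesgue_on D) v \<and> (\<exists>G. weak_gradient D v G)}"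

definition weak_laplacian ::
  "'a::euclidean_space set \<Rightarrow> ('a \<Rightarrow> complex) \<Rightarrow> ('a \<Rightarrow> complex) \<Rightarrow> bool" where
  "weak_laplacian D v f \<longleftrightarrow>
     square_integrable (lebesgue_on D) f \<and>
     (\<exists>G. weak_gradient D v G \<and>
        (\<forall>\<phi>. test_fun D \<phi> \<longrightarrow>
          (LINT x|lebesgue_on D. (\<Sum>b\<in>Basis. partial_deriv b \<phi> x *\<^sub>R G b x)) =
          - (LINT x|lebesgue_on D. \<phi> x *\<^sub>R f x)))"

text \<open>
  The boundary trace of a Sobolev function on a polyhedral domain is, at almost every boundary
  point, its one-sided approximate limit: the number \<open>c\<close> for which the mean of \<open>|v - c|\<close> over
  \<open>D \<inter> ball x r\<close> tends to \<open>0\<close> (Evans--Gariepy, Measure Theory and Fine Properties of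
  Functions, Section 5.3). It equals \<open>v x\<close> where \<open>v\<close> is continuous up to the boundary.
\<close>

definition has_trace_at ::
  "'a::euclidean_space set \<Rightarrow> ('a \<Rightarrow> complex) \<Rightarrow> 'a \<Rightarrow> complex \<Rightarrow> bool" where
  "has_trace_at D v x c \<longleftrightarrow>
     ((\<lambda>r. (LINT y|lebesgue_on (D \<inter> ball x r). cmod (v y - c))
            / measure lebesgue (D \<inter> ball x r)) \<longlongrightarrow> 0) (at_right 0)"

definition bdry_trace :: "'a::euclidean_space set \<Rightarrow> ('a \<Rightarrow> complex) \<Rightarrow> 'a \<Rightarrow> complex" where
  "bdry_trace D v x = (THE c. has_trace_at D v x c)"

definition has_L2_trace :: "'a::euclidean_space set \<Rightarrow> ('a \<Rightarrow> complex) \<Rightarrow> bool" where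
  "has_L2_trace D v \<longleftrightarrow>
     (AE x in surface_on (frontier D). \<exists>c. has_trace_at D v x c) \<and>
     square_integrable (surface_on (frontier D)) (bdry_trace D v)"

text \<open>
  The outward normal derivative of an \<open>H\<^sup>1\<close> function with square-integrable Laplacian is, as
  usual, the functional on the boundary defined by Green's formula
  \<open>\<integral>\<^sub>D (\<nabla>v \<cdot> \<nabla>\<phi> + \<Delta>v \<phi>) dx = \<integral>\<^sub>\<partial>\<^sub>D q \<phi> ds\<close>, here required to be represented by a
  square-integrable function \<open>q\<close>. The integrals are bilinear, so real \<open>\<phi>\<close> suffice. The formula
  determines \<open>q\<close> up to surface-null sets, so the choice below only picks a representative.
\<close>

definition has_L2_normal_deriv ::
  "'a::euclidean_space set \<Rightarrow> ('a \<Rightarrow> complex) \<Rightarrow> ('a \<Rightarrow> complex) \<Rightarrow> bool" where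
  "has_L2_normal_deriv D v q \<longleftrightarrow>
     square_integrable (surface_on (frontier D)) q \<and>
     (\<exists>G f. weak_gradient D v G \<and> weak_laplacian D v f \<and>
        (\<forall>\<phi>. C1_fun \<phi> \<longrightarrow>
          has_bochner_integral (surface_on (frontier D)) (\<lambda>x. \<phi> x *\<^sub>R q x)
            (LINT x|lebesgue_on D.
               (\<Sum>b\<in>Basis. partial_deriv b \<phi> x *\<^sub>R G b x) + \<phi> x *\<^sub>R f x)))"

definition normal_deriv :: "'a::euclidean_space set \<Rightarrow> ('a \<Rightarrow> complex) \<Rightarrow> 'a \<Rightarrow> complex" where
  "normal_deriv D v = (SOME q. has_L2_normal_deriv D v q)"

text \<open>The local space of \<open>H\<^sup>1\<close> solutions of \<open>- \<Delta>v - \<omega>\<^sup>2 v = 0\<close> with square-integrable Cauchy data.\<close>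

definition local_space :: "real \<Rightarrow> 'a::euclidean_space set \<Rightarrow> ('a \<Rightarrow> complex) set" where
  "local_space \<omega> D =
     {v \<in> H1 D. weak_laplacian D v (\<lambda>x. - (complex_of_real \<omega>)\<^sup>2 * v x) \<and>
        has_L2_trace D v \<and> (\<exists>q. has_L2_normal_deriv D v q)}"


section \<open>The discontinuous Galerkin setting\<close>

text \<open>\<open>D = interior (closure D)\<close> excludes slits, so that \<open>D\<close> lies on one side of each boundary face.\<close>

definition polyhedral_domain :: "'a::euclidean_space set \<Rightarrow> bool" where
  "polyhedral_domain D \<longleftrightarrow>
     open D \<and> connected D \<and> D \<noteq> {} \<and> bounded D \<and> D = interior (closure D) \<and>
     (\<exists>F. finite F \<and> (\<forall>P\<in>F. polytope P) \<and> closure D = \<Union>F)"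

text \<open>Elements need not meet face to face, so hanging nodes are allowed.\<close>

definition partition_of :: "'a::euclidean_space set \<Rightarrow> nat \<Rightarrow> (nat \<Rightarrow> 'a set) \<Rightarrow> bool" where
  "partition_of D N T \<longleftrightarrow>
     (\<forall>k\<in>{1..N}. polyhedral_domain (T k)) \<and>
     (\<forall>k\<in>{1..N}. \<forall>j\<in>{1..N}. j \<noteq> k \<longrightarrow> T k \<inter> T j = {}) \<and>
     (\<Union>k\<in>{1..N}. closure (T k)) = closure D"

record 'd helmholtz_dg =
  Dom :: "(real ^ 'd) set"
  num_elems :: nat
  elem :: "nat \<Rightarrow> (real ^ 'd) set"
  wavenum :: real
  jump_coeff :: real
  flux_coeff :: real
  bdry_data :: "real ^ 'd \<Rightarrow> complex"

definition valid_dg :: "'d::finite helmholtz_dg \<Rightarrow> bool" where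
  "valid_dg P \<longleftrightarrow>
     (CARD('d) = 2 \<or> CARD('d) = 3) \<and>
     polyhedral_domain (Dom P) \<and> partition_of (Dom P) (num_elems P) (elem P) \<and>
     wavenum P > 0 \<and> jump_coeff P > 0 \<and> flux_coeff P > 0 \<and>
     square_integrable (surface_on (frontier (Dom P))) (bdry_data P)"

definition interface :: "'d::finite helmholtz_dg \<Rightarrow> nat \<Rightarrow> nat \<Rightarrow> (real ^ 'd) set" where
  "interface P k j = frontier (elem P k) \<inter> frontier (elem P j)"

definition outer_bdry :: "'d::finite helmholtz_dg \<Rightarrow> nat \<Rightarrow> (real ^ 'd) set" where
  "outer_bdry P k = closure (elem P k) \<inter> frontier (Dom P)"

definition V_space :: "'d::finite helmholtz_dg \<Rightarrow> (real ^ 'd \<Rightarrow> complex) set" where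
  "V_space P =
     {v. square_integrable (lebesgue_on (Dom P)) v \<and>
         (\<forall>k\<in>{1..num_elems P}. v \<in> local_space (wavenum P) (elem P k))}"

text \<open>On \<open>outer_bdry P k\<close> the outward normals of \<open>Dom P\<close> and of the element \<open>k\<close> agree.\<close>

definition impedance :: "'d::finite helmholtz_dg \<Rightarrow> nat \<Rightarrow> (real ^ 'd \<Rightarrow> complex) \<Rightarrow> real ^ 'd \<Rightarrow> complex" where
  "impedance P k v x =
     normal_deriv (elem P k) v x + \<i> * complex_of_real (wavenum P) * bdry_trace (elem P k) v x"

definition value_jump ::
  "'d::finite helmholtz_dg \<Rightarrow> nat \<Rightarrow> nat \<Rightarrow> (real ^ 'd \<Rightarrow> complex) \<Rightarrow> real ^ 'd \<Rightarrow> complex" where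
  "value_jump P k j v x = bdry_trace (elem P k) v x - bdry_trace (elem P j) v x"

definition flux_jump ::
  "'d::finite helmholtz_dg \<Rightarrow> nat \<Rightarrow> nat \<Rightarrow> (real ^ 'd \<Rightarrow> complex) \<Rightarrow> real ^ 'd \<Rightarrow> complex" where
  "flux_jump P k j v x = normal_deriv (elem P k) v x + normal_deriv (elem P j) v x"

definition dg_form ::
  "'d::finite helmholtz_dg \<Rightarrow> (real ^ 'd \<Rightarrow> complex) \<Rightarrow> (real ^ 'd \<Rightarrow> complex) \<Rightarrow> complex" where
  "dg_form P u v =
     (\<Sum>k\<in>{1..num_elems P}.
        (LINT x|surface_on (outer_bdry P k). impedance P k u x * cnj (impedance P k v x)) +
        (\<Sum>j\<in>{1..num_elems P} - {k}.
           complex_of_real (jump_coeff P) *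
             (LINT x|surface_on (interface P k j). value_jump P k j u x * cnj (value_jump P k j v x)) +
           complex_of_real (flux_coeff P) *
             (LINT x|surface_on (interface P k j). flux_jump P k j u x * cnj (flux_jump P k j v x))))"

definition dg_load :: "'d::finite helmholtz_dg \<Rightarrow> (real ^ 'd \<Rightarrow> complex) \<Rightarrow> complex" where
  "dg_load P v =
     (\<Sum>k\<in>{1..num_elems P}.
        LINT x|surface_on (outer_bdry P k). bdry_data P x * cnj (impedance P k v x))"

text \<open>\<open>dg_form P v v\<close> is a nonnegative real number, so \<open>Re\<close> discards nothing.\<close>

definition dg_norm :: "'d::finite helmholtz_dg \<Rightarrow> (real ^ 'd \<Rightarrow> complex) \<Rightarrow> real" where
  "dg_norm P v = sqrt (Re (dg_form P v v))"

definition dg_ball :: "'d::finite helmholtz_dg \<Rightarrow> (real ^ 'd \<Rightarrow> complex) set" where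
  "dg_ball P = {v \<in> V_space P. dg_norm P v \<le> 1}"

definition solves_dg :: "'d::finite helmholtz_dg \<Rightarrow> (real ^ 'd \<Rightarrow> complex) \<Rightarrow> bool" where
  "solves_dg P u \<longleftrightarrow> u \<in> V_space P \<and> (\<forall>v\<in>V_space P. dg_form P u v = dg_load P v)"

text \<open>Elements of \<open>V_space P\<close> are representatives of almost-everywhere classes.\<close>

definition unique_solution :: "'d::finite helmholtz_dg \<Rightarrow> (real ^ 'd \<Rightarrow> complex) \<Rightarrow> bool" where
  "unique_solution P u \<longleftrightarrow>
     solves_dg P u \<and>
     (\<forall>w. solves_dg P w \<longrightarrow> (AE x in lebesgue_on (Dom P). w x = u x))"


section \<open>Plane wave networks and the recursive procedure\<close>

definition pw_network :: "'d::finite helmholtz_dg \<Rightarrow> nat \<Rightarrow> (real ^ 'd \<Rightarrow> complex) set" where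
  "pw_network P n =
     {v. \<forall>k\<in>{1..num_elems P}.
           \<exists>(c :: nat \<Rightarrow> complex) (W :: nat \<Rightarrow> real ^ 'd).
             (\<forall>j\<in>{1..n}. norm (W j) = 1) \<and>
             (\<forall>x\<in>elem P k.
                v x = (\<Sum>j\<in>{1..n}. c j * exp (\<i> * complex_of_real (wavenum P * (W j \<bullet> x)))))}"

definition residual ::
  "'d::finite helmholtz_dg \<Rightarrow> (real ^ 'd \<Rightarrow> complex) \<Rightarrow> (real ^ 'd \<Rightarrow> complex) \<Rightarrow> real" where
  "residual P w v = Re (dg_load P v - dg_form P w v)"

definition quasi_maximizer ::
  "'d::finite helmholtz_dg \<Rightarrow> (real ^ 'd \<Rightarrow> complex) \<Rightarrow> (real ^ 'd \<Rightarrow> complex) \<Rightarrow> real \<Rightarrow> nat \<Rightarrow>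
     (real ^ 'd \<Rightarrow> complex) \<Rightarrow> bool" where
  "quasi_maximizer P u w \<epsilon> n \<phi> \<longleftrightarrow>
     \<phi> \<in> pw_network P n \<inter> dg_ball P \<and>
     residual P w \<phi> \<ge>
       (SUP v\<in>pw_network P n \<inter> dg_ball P. residual P w v) - \<epsilon> * dg_norm P (\<lambda>x. u x - w x)"

definition complex_span :: "(nat \<Rightarrow> 'a \<Rightarrow> complex) \<Rightarrow> nat \<Rightarrow> ('a \<Rightarrow> complex) set" where
  "complex_span \<phi> j = {v. \<exists>c :: nat \<Rightarrow> complex. v = (\<lambda>x. \<Sum>m\<in>{1..j}. c m * \<phi> m x)}"

definition galerkin_solution ::
  "'d::finite helmholtz_dg \<Rightarrow> (real ^ 'd \<Rightarrow> complex) set \<Rightarrow> (real ^ 'd \<Rightarrow> complex) \<Rightarrow> bool" where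
  "galerkin_solution P S w \<longleftrightarrow> w \<in> S \<and> (\<forall>v\<in>S. dg_form P w v = dg_load P v)"

end

theory Submission
  imports Defs
begin

text \<open>
  Put \<open>e = u - u\<^sub>j\<^sub>-\<^sub>1\<close>, \<open>N = |||e|||\<close> and \<open>\<rho> = Re a(e, \<phi>\<^sub>j)\<close>. The Galerkin solution is at least as good
  as \<open>u\<^sub>j\<^sub>-\<^sub>1 + \<rho> \<phi>\<^sub>j\<close>, the best real multiple of the unit vector \<open>\<phi>\<^sub>j\<close>, whence
  \<open>|||u - u\<^sub>j|||\<^sup>2 \<le> N\<^sup>2 - \<rho>\<^sup>2\<close>. Since \<open>|||\<phi>\<^sub>j - e/N|||\<^sup>2 = 2 - 2 \<rho>/N\<close>, closeness up to \<open>\<epsilon>\<^sub>j\<close> gives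
  \<open>\<rho> \<ge> N (1 - \<epsilon>\<^sub>j\<^sup>2/2)\<close>, and \<open>1 - (1 - \<epsilon>\<^sub>j\<^sup>2/2)\<^sup>2 < \<epsilon>\<^sub>j\<^sup>2\<close> makes the contraction strict.

  The analytic content is that \<open>a\<close> is sesquilinear although traces and normal derivatives are
  chosen pointwise: a trace is a limit of means, hence unique, and a normal derivative is unique
  almost everywhere because \<open>C\<^sup>1\<close> test functions separate integrable functions with respect to
  every measure on the Borel sets.
\<close>

section \<open>Test functions separate integrable functions\<close>

lemma C1_funI:
  assumes "\<And>x. (\<phi> has_derivative \<phi>' x) (at x)"
    and "\<And>b. b \<in> Basis \<Longrightarrow> continuous_on UNIV (\<lambda>x. \<phi>' x b)"
  shows "C1_fun \<phi>"
proof -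
  \<comment> \<open>\<open>frechet_derivative\<close> is a choice; uniqueness of the derivative
    identifies it with the explicit \<open>\<phi>'\<close>.\<close>
  have "frechet_derivative \<phi> (at x) = \<phi>' x" for x
    using frechet_derivative_at[OF assms(1)] by simp
  with assms show ?thesis
    unfolding C1_fun_def differentiable_def by auto
qed

lemma C1_fun_has_derivative:
  "C1_fun \<phi> \<Longrightarrow> (\<phi> has_derivative frechet_derivative \<phi> (at x)) (at x)"
  by (simp add: C1_fun_def frechet_derivative_works)

lemma C1_fun_continuous_on: "C1_fun \<phi> \<Longrightarrow> continuous_on S \<phi>"
  by (meson C1_fun_has_derivative continuous_at_imp_continuous_on has_derivative_continuous)

lemma C1_fun_borel_measurable: "C1_fun \<phi> \<Longrightarrow> \<phi> \<in> borel_measurable borel"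
  by (simp add: C1_fun_continuous_on borel_measurable_continuous_onI)

lemma C1_fun_const: "C1_fun (\<lambda>x. c)"
  by (rule C1_funI[where \<phi>' = "\<lambda>_ _. 0"]) auto

lemma C1_fun_mult:
  assumes "C1_fun f" "C1_fun g"
  shows "C1_fun (\<lambda>x. f x * g x)"
proof (rule C1_funI)
  show "((\<lambda>x. f x * g x) has_derivative
      (\<lambda>h. f x * frechet_derivative g (at x) h + frechet_derivative f (at x) h * g x)) (at x)" for x
    by (intro has_derivative_mult C1_fun_has_derivative assms)
  show "continuous_on UNIV
      (\<lambda>x. f x * partial_deriv b g x + partial_deriv b f x * g x)" if "b \<in> Basis" for b
    using assms that
    by (intro continuous_on_add continuous_on_mult C1_fun_continuous_on[OF assms(1)]
        C1_fun_continuous_on[OF assms(2)]) (auto simp: C1_fun_def)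
qed

lemma C1_fun_prod:
  "(\<And>i. i \<in> I \<Longrightarrow> C1_fun (f i)) \<Longrightarrow> C1_fun (\<lambda>x. \<Prod>i\<in>I. f i x)"
  by (induction I rule: infinite_finite_induct) (auto intro: C1_fun_const C1_fun_mult)

lemma C1_fun_compose:
  assumes "C1_fun f" "\<And>t. (h has_real_derivative h' t) (at t)" "continuous_on UNIV h'"
  shows "C1_fun (\<lambda>x. h (f x))"
proof (rule C1_funI)
  show "((\<lambda>x. h (f x)) has_derivative (\<lambda>k. frechet_derivative f (at x) k * h' (f x))) (at x)" for x
    by (rule DERIV_compose_FDERIV[OF assms(2) C1_fun_has_derivative[OF assms(1)]])
  show "continuous_on UNIV (\<lambda>x. partial_deriv b f x * h' (f x))" if "b \<in> Basis" for b
    using that assms continuous_on_compose[OF C1_fun_continuous_on[OF assms(1)], of UNIV h']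
    by (intro continuous_intros) (auto simp: C1_fun_def o_def intro: continuous_on_subset)
qed

lemma C1_fun_affine: "C1_fun (\<lambda>x. c * (x \<bullet> i) + d)"
  by (rule C1_funI[where \<phi>' = "\<lambda>x h. c * (h \<bullet> i)"])
    (auto intro!: derivative_eq_intros)

text \<open>Squaring removes the kink of the positive part: at 0 the difference quotient is bounded
  by the absolute value of \<open>h\<close>. The result is a C1 function that vanishes on a
  half-line, the building block for bumps.\<close>

lemma max_0_square_derivative:
  "((\<lambda>t::real. (max 0 t)\<^sup>2) has_real_derivative 2 * max 0 t) (at t)"
proof -
  consider "t < 0" | "t = 0" | "t > 0" by linarith
  then show ?thesis
  proof cases
    case 1
    have "((\<lambda>t::real. 0) has_real_derivative 0) (at t)" by simp
    then have "((\<lambda>t::real. (max 0 t)\<^sup>2) has_real_derivative 0) (at t)"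
      by (rule has_field_derivative_transform_within_open[where S = "{..<0}"]) (use 1 in auto)
    with 1 show ?thesis by simp
  next
    case 2
    have "((\<lambda>h::real. (max 0 h)\<^sup>2 / h) \<longlongrightarrow> 0) (at 0)"
    proof (rule Lim_null_comparison)
      show "\<forall>\<^sub>F h::real in at 0. norm ((max 0 h)\<^sup>2 / h) \<le> \<bar>h\<bar>"
        by (rule always_eventually) (auto simp: max_def power2_eq_square)
      show "((\<lambda>h::real. \<bar>h\<bar>) \<longlongrightarrow> 0) (at 0)"
        by (auto intro!: tendsto_eq_intros)
    qed
    with 2 show ?thesis by (simp add: DERIV_def)
  next
    case 3
    have "((\<lambda>t::real. t\<^sup>2) has_real_derivative 2 * t) (at t)"
      by (auto intro!: derivative_eq_intros)
    then have "((\<lambda>t::real. (max 0 t)\<^sup>2) has_real_derivative 2 * t) (at t)"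
      by (rule has_field_derivative_transform_within_open[where S = "{0<..}"]) (use 3 in auto)
    with 3 show ?thesis by simp
  qed
qed

text \<open>These are C1 substitutes for the indicator of an open box. The hypothesis concerns the
  closed box because the supports lie there; the uniform bound prepares for dominated
  convergence.\<close>

lemma box_bump_sequence:
  fixes a b :: "'a::euclidean_space"
  assumes "cbox a b \<subseteq> D"
  obtains \<psi> :: "nat \<Rightarrow> 'a \<Rightarrow> real"
  where "\<And>n. test_fun D (\<psi> n)" "\<And>n x. \<bar>\<psi> n x\<bar> \<le> 1"
    "\<And>x. (\<lambda>n. \<psi> n x) \<longlonglongrightarrow> indicator (box a b) x"
proof
  \<comment> \<open>\<open>p\<close> is a \<open>C\<^sup>1\<close> function that is positive exactly on the box; \<open>1 - exp (- n p)\<close> saturates it.\<close>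
  define p :: "'a \<Rightarrow> real" where
    "p x = (\<Prod>i\<in>Basis. (max 0 (x \<bullet> i - a \<bullet> i))\<^sup>2 * (max 0 (b \<bullet> i - x \<bullet> i))\<^sup>2)" for x
  define \<psi> where "\<psi> n x = 1 - exp (- (real n * p x))" for n x
  have p_nonneg: "p x \<ge> 0" for x
    unfolding p_def by (intro prod_nonneg) auto
  have p_zero: "p x = 0 \<longleftrightarrow> x \<notin> box a b" for x
  proof -
    have "max 0 t = 0 \<longleftrightarrow> t \<le> 0" for t :: real by auto
    then show ?thesis
      unfolding p_def by (simp add: mem_box not_less Bex_def)
  qed
  have sq: "C1_fun (\<lambda>x. (max 0 (c * (x \<bullet> i) + d))\<^sup>2)" for c d and i :: 'a
    by (rule C1_fun_compose[OF C1_fun_affine max_0_square_derivative])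
      (intro continuous_intros)
  have "C1_fun p"
  proof -
    have "C1_fun (\<lambda>x. (max 0 (x \<bullet> i - a \<bullet> i))\<^sup>2)" for i
      using sq[of 1 i "- (a \<bullet> i)"] by simp
    moreover have "C1_fun (\<lambda>x. (max 0 (b \<bullet> i - x \<bullet> i))\<^sup>2)" for i
      using sq[of "-1" i "b \<bullet> i"] by simp
    ultimately show ?thesis
      unfolding p_def by (intro C1_fun_prod C1_fun_mult)
  qed
  then have C1: "C1_fun (\<psi> n)" for n
    unfolding \<psi>_def
    by (rule C1_fun_compose[where h' = "\<lambda>t. real n * exp (- (real n * t))"])
      (auto intro!: derivative_eq_intros continuous_intros)
  show "test_fun D (\<psi> n)" for n
  proof -
    have "{x. \<psi> n x \<noteq> 0} \<subseteq> cbox a b"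
      using p_zero by (auto simp: \<psi>_def intro: subsetD[OF box_subset_cbox])
    then have "closure {x. \<psi> n x \<noteq> 0} \<subseteq> cbox a b"
      by (intro closure_minimal closed_cbox)
    moreover from this have "compact (closure {x. \<psi> n x \<noteq> 0})"
      using compact_Int_closed[OF compact_cbox closed_closure] by (metis inf.absorb_iff2)
    ultimately show ?thesis
      unfolding test_fun_def using C1[of n] assms by simp
  qed
  show "\<bar>\<psi> n x\<bar> \<le> 1" for n x
    using p_nonneg[of x] by (simp add: \<psi>_def)
  show "(\<lambda>n. \<psi> n x) \<longlonglongrightarrow> indicator (box a b) x" for x
  proof (cases "x \<in> box a b")
    case True
    then have "p x > 0" using p_zero p_nonneg[of x] by fastforce
    then have "filterlim (\<lambda>n. p x * real n) at_top sequentially"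
      by (intro filterlim_tendsto_pos_mult_at_top[OF tendsto_const _ filterlim_real_sequentially])
    then have "filterlim (\<lambda>n. - (real n * p x)) at_bot sequentially"
      by (simp add: filterlim_uminus_at_top mult.commute)
    then have "(\<lambda>n. exp (- (real n * p x))) \<longlonglongrightarrow> 0"
      by (rule filterlim_compose[OF exp_at_bot])
    then have "(\<lambda>n. \<psi> n x) \<longlonglongrightarrow> 1 - 0"
      unfolding \<psi>_def by (intro tendsto_diff tendsto_const)
    with True show ?thesis by simp
  next
    case False
    then have "p x = 0" using p_zero by blast
    with False show ?thesis by (simp add: \<psi>_def)
  qed
qed

text \<open>Dominated convergence along the bumps replaces test functions by indicators of boxes,
  the pi-lambda theorem passes to Borel sets, and Borel parts of measurable sets handle the
  completion. An integrable function whose integral vanishes over every measurable set is zero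
  almost everywhere.\<close>

lemma AE_zero_on_box:
  fixes g :: "'a::euclidean_space \<Rightarrow> real"
  assumes sets_N: "sets N = sets borel" and g: "integrable (completion N) g"
    and zero: "\<And>\<phi>. test_fun D \<phi> \<Longrightarrow> (LINT x|completion N. \<phi> x * g x) = 0"
    and cd: "cbox c d \<subseteq> D"
  shows "AE x in completion N. x \<in> box c d \<longrightarrow> g x = 0"
proof -
  let ?M = "completion N"
  \<comment> \<open>Cutting \<open>g\<close> off to the box makes the integral over the whole space
    vanish, as the complement step of the pi-lambda argument needs.\<close>
  define h where "h x = indicator (box c d) x * g x" for x
  have borel_M: "A \<in> sets ?M" if "A \<in> sets borel" for A
    using that sets_N by auto
  have meas: "\<phi> \<in> borel_measurable ?M" if "\<phi> \<in> borel_measurable borel" for \<phi> :: "'a \<Rightarrow> real"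
    using that sets_N by (intro measurable_completion) (simp cong: measurable_cong_sets)
  have h: "integrable ?M h"
    unfolding h_def using integrable_real_mult_indicator[OF borel_M[of "box c d"] g]
    by (simp add: mult.commute)
  have on_box: "(LINT x|?M. indicator (box a b) x * g x) = 0" if ab: "cbox a b \<subseteq> D" for a b
  proof -
    obtain \<psi> :: "nat \<Rightarrow> 'a \<Rightarrow> real" where \<psi>: "\<And>n. test_fun D (\<psi> n)" "\<And>n x. \<bar>\<psi> n x\<bar> \<le> 1"
      "\<And>x. (\<lambda>n. \<psi> n x) \<longlonglongrightarrow> indicator (box a b) x"
      using box_bump_sequence[OF ab] by blast
    have "(\<lambda>n. LINT x|?M. \<psi> n x * g x) \<longlonglongrightarrow> (LINT x|?M. indicator (box a b) x * g x)"
    proof (rule integral_dominated_convergence[where w = "\<lambda>x. \<bar>g x\<bar>"])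
      show "(\<lambda>x. indicator (box a b) x * g x) \<in> borel_measurable ?M"
        using borel_M[of "box a b"] g by measurable
      show "(\<lambda>x. \<psi> n x * g x) \<in> borel_measurable ?M" for n
        using meas[OF C1_fun_borel_measurable, of "\<psi> n"] \<psi>(1)[of n] g
        by (auto simp: test_fun_def)
      show "AE x in ?M. (\<lambda>n. \<psi> n x * g x) \<longlonglongrightarrow> indicator (box a b) x * g x"
        using \<psi>(3) by (auto intro!: tendsto_intros)
      show "AE x in ?M. norm (\<psi> n x * g x) \<le> \<bar>g x\<bar>" for n
        using \<psi>(2)[of n] by (auto simp: abs_mult intro!: mult_left_le_one_le)
    qed (use g in auto)
    then show ?thesis
      using zero[OF \<psi>(1)] by (simp add: LIMSEQ_const_iff)
  qed
  have total: "(LINT x|?M. h x) = 0"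
    unfolding h_def by (rule on_box[OF cd])
  have borel_zero: "(LINT x|?M. indicator A x * h x) = 0" if "A \<in> sets borel" for A
  proof -
    have A: "A \<in> sigma_sets UNIV (range (\<lambda>(a, b). box a b))"
      using that unfolding borel_eq_box by simp
    have "Int_stable (range (\<lambda>(a, b). box a b :: 'a set))"
      by (auto simp: Int_stable_def box_Int_box)
    moreover have "range (\<lambda>(a, b). box a b) \<subseteq> Pow (UNIV :: 'a set)" by simp
    ultimately show ?thesis using A
    proof (induction rule: sigma_sets_induct_disjoint)
      case (basic A)
      then obtain a b where A: "A = box a b" by auto
      have "indicator A x * h x = indicator (box a b \<inter> box c d) x * g x" for x
        by (simp add: A h_def indicator_def)
      moreover have "(LINT x|?M. indicator (box a b \<inter> box c d) x * g x) = 0"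
      proof (cases "box a b \<inter> box c d = {}")
        case False
        obtain a' b' where ab': "box a b \<inter> box c d = box a' b'"
          using box_Int_box[of a b c d] by blast
        \<comment> \<open>For a nonempty box the closure is the closed box, which therefore stays
          inside \<open>cbox c d\<close> and \<open>D\<close>. The empty case is separated because
          this identity can fail there.\<close>
        have "cbox a' b' = closure (box a b \<inter> box c d)"
          using False by (simp add: ab')
        also have "\<dots> \<subseteq> closure (box c d)"
          by (intro closure_mono) auto
        also have "\<dots> \<subseteq> cbox c d"
          by (intro closure_minimal box_subset_cbox closed_cbox)
        finally show ?thesis
          unfolding ab' using on_box cd by blast
      qed simp
      ultimately show ?case by simp
    next
      case empty
      then show ?case by simp
    next
      case (compl A)
      have A: "A \<in> sets ?M" using compl.hyps by (intro borel_M) (simp add: borel_eq_box)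
      have "indicator (UNIV - A) x * h x = h x - indicator A x * h x" for x
        by (auto simp: indicator_def)
      then show ?case
        using compl.IH total h integrable_real_mult_indicator[OF A h]
        by (simp add: mult.commute[of "h _"])
    next
      case (union F)
      have F: "F i \<in> sets ?M" for i
        using union.hyps(2) by (intro borel_M) (auto simp add: borel_eq_box)
      have "(LINT x:(\<Union>i. F i)|?M. h x) = (\<Sum>i. LINT x:(F i)|?M. h x)"
      proof (rule lebesgue_integral_countable_add[OF F])
        show "F i \<inter> F j = {}" if "i \<noteq> j" for i j
          using that union.hyps(1) by (auto simp: disjoint_family_on_def)
        show "set_integrable ?M (\<Union>i. F i) h"
          unfolding set_integrable_def using F h by (intro integrable_mult_indicator) auto
      qed
      then show ?case
        using union.IH by (simp add: set_lebesgue_integral_def)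
    qed
  qed
  have "AE x in ?M. h x = 0"
  proof (rule density_unique_real[OF h integrable_zero])
    fix A assume A: "A \<in> sets ?M"
    \<comment> \<open>\<open>A\<close> is measurable for the completion only; its
      \<open>main_part\<close> is a Borel set that differs from it by a null set.\<close>
    have ae: "AE x in ?M. indicator A x * h x = indicator (main_part N A) x * h x"
      using AE_completion[OF AE_in_main_part[OF A]] by eventually_elim (simp add: indicator_def)
    have main: "main_part N A \<in> sets borel"
      using main_part_sets[OF A] sets_N by simp
    have meas_ind: "(\<lambda>x. indicator B x * h x) \<in> borel_measurable ?M" if "B \<in> sets ?M" for B
      using that h by measurable
    have "(LINT x|?M. indicator A x * h x) = (LINT x|?M. indicator (main_part N A) x * h x)"
      by (rule integral_cong_AE[OF meas_ind[OF A] meas_ind[OF borel_M[OF main]] ae])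
    also have "\<dots> = 0"
      by (rule borel_zero[OF main])
    finally have "(LINT x|?M. indicator A x * h x) = 0" .
    then show "(LINT x:A|?M. h x) = (LINT x:A|?M. 0)"
      by (simp add: set_lebesgue_integral_def)
  qed
  then show ?thesis
    by eventually_elim (auto simp: h_def)
qed

text \<open>No \<open>\<sigma>\<close>-finiteness is assumed of \<open>N\<close>, so that the lemma applies to Lebesgue measure and to
  Hausdorff measure alike.\<close>

lemma AE_zero_of_test_integrals:
  fixes f :: "'a::euclidean_space \<Rightarrow> complex"
  assumes sets_N: "sets N = sets borel" and S: "S \<in> sets borel"
    and f: "integrable (restrict_space (completion N) S) f"
    and zero: "\<And>\<phi>. test_fun D \<phi> \<Longrightarrow> (LINT x|restrict_space (completion N) S. \<phi> x *\<^sub>R f x) = 0"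
    and D: "open D"
  shows "AE x in restrict_space (completion N) S. x \<in> D \<longrightarrow> f x = 0"
proof -
  let ?M = "completion N"
  \<comment> \<open>Extension by zero moves the problem from the restricted space to
    \<open>completion N\<close>, where \<open>AE_zero_on_box\<close> applies.\<close>
  define F where "F x = indicator S x *\<^sub>R f x" for x
  have S': "S \<inter> space ?M \<in> sets ?M"
    using S sets_N by auto
  have F: "integrable ?M F"
    using f S' unfolding F_def by (simp add: integrable_restrict_space set_integrable_def)
  have F_zero: "(LINT x|?M. \<phi> x *\<^sub>R F x) = 0" if "test_fun D \<phi>" for \<phi>
    using zero[OF that] S' unfolding F_def
    by (simp add: integral_restrict_space set_lebesgue_integral_def mult.commute)
  \<comment> \<open>A test function is bounded, being continuous with compact support. Integrability
    allows real and imaginary parts to be taken under the integral.\<close>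
  have F_int: "integrable ?M (\<lambda>x. \<phi> x *\<^sub>R F x)" if "test_fun D \<phi>" for \<phi>
  proof -
    have C1: "C1_fun \<phi>" and K: "compact (closure {x. \<phi> x \<noteq> 0})"
      using that by (auto simp: test_fun_def)
    obtain B where B: "\<And>x. x \<in> closure {x. \<phi> x \<noteq> 0} \<Longrightarrow> norm (\<phi> x) \<le> B"
      using compact_imp_bounded[OF compact_continuous_image[OF C1_fun_continuous_on[OF C1] K]]
      by (auto simp: bounded_iff)
    have "norm (\<phi> x) \<le> \<bar>B\<bar>" for x
    proof (cases "\<phi> x = 0")
      case False
      then have "x \<in> closure {x. \<phi> x \<noteq> 0}"
        by (intro subsetD[OF closure_subset]) simp
      from B[OF this] show ?thesis by simp
    qed simp
    then have *: "norm (\<phi> x *\<^sub>R F x) \<le> norm (\<bar>B\<bar> *\<^sub>R F x)" for x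
      by (auto intro!: mult_right_mono)
    have "\<phi> \<in> borel_measurable ?M"
      using C1_fun_borel_measurable[OF C1] sets_N
      by (intro measurable_completion) (simp cong: measurable_cong_sets)
    then have meas: "(\<lambda>x. \<phi> x *\<^sub>R F x) \<in> borel_measurable ?M"
      using F by auto
    have "integrable ?M (\<lambda>x. \<bar>B\<bar> *\<^sub>R F x)"
      using F by simp
    from this meas show ?thesis
      by (rule Bochner_Integration.integrable_bound) (use * in simp)
  qed
  have box0: "AE x in ?M. x \<in> box c d \<longrightarrow> F x = 0" if "cbox c d \<subseteq> D" for c d
  proof -
    have "AE x in ?M. x \<in> box c d \<longrightarrow> Re (F x) = 0"
    proof (rule AE_zero_on_box[OF sets_N _ _ that])
      show "(LINT x|?M. \<phi> x * Re (F x)) = 0" if "test_fun D \<phi>" for \<phi>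
        using integral_Re[OF F_int[OF that]] F_zero[OF that] by simp
    qed (use F in auto)
    moreover have "AE x in ?M. x \<in> box c d \<longrightarrow> Im (F x) = 0"
    proof (rule AE_zero_on_box[OF sets_N _ _ that])
      show "(LINT x|?M. \<phi> x * Im (F x)) = 0" if "test_fun D \<phi>" for \<phi>
        using integral_Im[OF F_int[OF that]] F_zero[OF that] by simp
    qed (use F in auto)
    ultimately show ?thesis
      by eventually_elim (auto simp: complex_eq_iff)
  qed
  \<comment> \<open>These boxes exhaust \<open>D\<close>, and Lindelof extracts countably many of
    them, so the exceptional null sets can be united.\<close>
  let ?B = "{box c d | c d. cbox c d \<subseteq> D}"
  have Un_B: "\<Union>?B = D"
  proof
    show "\<Union>?B \<subseteq> D"
      by (auto intro: subsetD[OF box_subset_cbox])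
    show "D \<subseteq> \<Union>?B"
    proof
      fix x assume "x \<in> D"
      then obtain c d where "cbox c d \<subseteq> D" "x \<in> box c d"
        using open_contains_cbox[OF D] by metis
      then show "x \<in> \<Union>?B" by auto
    qed
  qed
  have open_B: "open X" if "X \<in> ?B" for X
    using that by (auto simp: open_box)
  obtain \<D> where \<D>: "\<D> \<subseteq> ?B" and "countable \<D>" and "\<Union>\<D> = \<Union>?B"
    using Lindelof[OF open_B] .
  from this(3) Un_B have Un: "\<Union>\<D> = D"
    by (rule trans)
  have "AE x in ?M. \<forall>X\<in>\<D>. x \<in> X \<longrightarrow> F x = 0"
  proof (rule AE_ball_countable[THEN iffD2, OF \<open>countable \<D>\<close>], rule ballI)
    fix X assume "X \<in> \<D>"
    with \<D> have "X \<in> ?B" by (rule subsetD)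
    then obtain c d where X: "X = box c d" "cbox c d \<subseteq> D" by auto
    show "AE x in ?M. x \<in> X \<longrightarrow> F x = 0"
      unfolding X(1) by (rule box0[OF X(2)])
  qed
  then have "AE x in ?M. x \<in> D \<longrightarrow> F x = 0"
    by (rule eventually_mono) (auto simp: Un[symmetric])
  then have "AE x in ?M. x \<in> S \<longrightarrow> x \<in> D \<longrightarrow> f x = 0"
    by (rule eventually_mono) (auto simp: F_def)
  then show ?thesis
    using AE_restrict_space_iff[OF S'] by simp
qed

section \<open>Square-integrable functions and the surface measure\<close>

lemma square_integrable_lincomb:
  assumes f: "square_integrable M f" and g: "square_integrable M g"
  shows "square_integrable M (\<lambda>x. a * f x + b * g x)"
  unfolding square_integrable_def
proof
  have [measurable]: "f \<in> borel_measurable M" "g \<in> borel_measurable M"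
    using f g by (auto simp: square_integrable_def)
  show meas: "(\<lambda>x. a * f x + b * g x) \<in> borel_measurable M" by measurable
  have int: "integrable M (\<lambda>x. 2 * (cmod a)\<^sup>2 * (cmod (f x))\<^sup>2 + 2 * (cmod b)\<^sup>2 * (cmod (g x))\<^sup>2)"
    using f g by (auto simp: square_integrable_def)
  have "(cmod (a * f x + b * g x))\<^sup>2 \<le> 2 * (cmod a)\<^sup>2 * (cmod (f x))\<^sup>2 + 2 * (cmod b)\<^sup>2 * (cmod (g x))\<^sup>2"
    for x
  proof -
    have "(cmod (a * f x + b * g x))\<^sup>2 \<le> (cmod a * cmod (f x) + cmod b * cmod (g x))\<^sup>2"
      by (intro power_mono) (auto simp: norm_triangle_ineq norm_mult[symmetric])
    also have "\<dots> \<le> 2 * (cmod a * cmod (f x))\<^sup>2 + 2 * (cmod b * cmod (g x))\<^sup>2"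
      using sum_squares_bound[of "cmod a * cmod (f x)" "cmod b * cmod (g x)"]
      unfolding power2_sum by linarith
    finally show ?thesis by (simp add: power_mult_distrib)
  qed
  then show "integrable M (\<lambda>x. (cmod (a * f x + b * g x))\<^sup>2)"
    by (intro Bochner_Integration.integrable_bound[OF int]) auto
qed

text \<open>The product is dominated by the sum of the squares. This makes the integrals in
  \<open>dg_form\<close> genuine for functions in \<open>V_space\<close>.\<close>

lemma square_integrable_mult_cnj:
  assumes f: "square_integrable M f" and g: "square_integrable M g"
  shows "integrable M (\<lambda>x. f x * cnj (g x))"
proof (rule Bochner_Integration.integrable_bound)
  show "integrable M (\<lambda>x. (cmod (f x))\<^sup>2 + (cmod (g x))\<^sup>2)"
    using f g by (auto simp: square_integrable_def)
  have [measurable]: "f \<in> borel_measurable M" "g \<in> borel_measurable M"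
    using f g by (auto simp: square_integrable_def)
  have "(\<lambda>x. cnj (g x)) \<in> borel_measurable M"
    by (rule borel_measurable_continuous_on[OF _ \<open>g \<in> borel_measurable M\<close>]) (intro continuous_intros)
  then show "(\<lambda>x. f x * cnj (g x)) \<in> borel_measurable M" by measurable
  have "cmod (f x) * cmod (g x) \<le> (cmod (f x))\<^sup>2 + (cmod (g x))\<^sup>2" for x
    using sum_squares_bound[of "cmod (f x)" "cmod (g x)"]
      mult_nonneg_nonneg[OF norm_ge_zero[of "f x"] norm_ge_zero[of "g x"]] by linarith
  then show "AE x in M. norm (f x * cnj (g x)) \<le> norm ((cmod (f x))\<^sup>2 + (cmod (g x))\<^sup>2)"
    by (simp add: norm_mult)
qed

lemma square_integrable_imp_integrable:
  assumes "finite_measure M" and f: "square_integrable M f"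
  shows "integrable M f"
proof (rule Bochner_Integration.integrable_bound)
  interpret finite_measure M by fact
  show "integrable M (\<lambda>x. 1 + (cmod (f x))\<^sup>2)"
    using f by (auto simp: square_integrable_def)
  \<comment> \<open>Since the square of \<open>cmod (f x) - 1\<close> is nonnegative, even twice
    \<open>cmod (f x)\<close> is at most the right-hand side.\<close>
  have "cmod (f x) \<le> 1 + (cmod (f x))\<^sup>2" for x
    using zero_le_power2[of "cmod (f x) - 1"] norm_ge_zero[of "f x"]
    unfolding power2_diff power_one by linarith
  then show "AE x in M. norm (f x) \<le> norm (1 + (cmod (f x))\<^sup>2)"
    by simp
qed (use f in \<open>simp add: square_integrable_def\<close>)

text \<open>Preimages under \<open>f\<close> and \<open>g\<close> differ by a null set, which
  completeness makes measurable. The use is for \<open>bdry_trace\<close>, whose values are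
  identified only almost everywhere.\<close>

lemma (in complete_measure) borel_measurable_cong_AE:
  fixes f g :: "'a \<Rightarrow> 'b::topological_space"
  assumes f: "f \<in> borel_measurable M" and ae: "AE x in M. f x = g x"
  shows "g \<in> borel_measurable M"
proof (rule measurableI)
  fix A :: "'b set" assume A: "A \<in> sets borel"
  have "AE x in M. x \<in> f -` A \<inter> space M \<longleftrightarrow> x \<in> g -` A \<inter> space M"
    using ae by (rule eventually_mono) simp
  then show "g -` A \<inter> space M \<in> sets M"
    by (rule in_sets_AE) (use measurable_sets[OF f A] in auto)
qed simp

lemma (in complete_measure) square_integrable_cong_AE:
  assumes f: "square_integrable M f" and ae: "AE x in M. f x = g x"
  shows "square_integrable M g"
  unfolding square_integrable_def
proof
  show g: "g \<in> borel_measurable M"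
    using f ae borel_measurable_cong_AE unfolding square_integrable_def by blast
  have "AE x in M. (cmod (f x))\<^sup>2 = (cmod (g x))\<^sup>2"
    using ae by eventually_elim simp
  then show "integrable M (\<lambda>x. (cmod (g x))\<^sup>2)"
    using f g unfolding square_integrable_def
    by (subst integrable_cong_AE[symmetric, where f = "\<lambda>x. (cmod (f x))\<^sup>2"]) auto
qed

text \<open>The measure behind \<open>surface_on\<close> before completion and restriction, in the
  shape that \<open>AE_zero_of_test_integrals\<close> expects of \<open>N\<close>.\<close>

definition surface_base :: "'a::euclidean_space measure" where
  "surface_base = measure_of UNIV (sets borel) (hausdorff_outer (DIM('a) - 1))"

lemma surface_on_eq: "surface_on \<Gamma> = restrict_space (completion surface_base) \<Gamma>"
  by (simp add: surface_on_def surface_base_def)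

text \<open>The sigma-algebra of \<open>measure_of\<close> is generated by the given sets, whatever
  the set function, and the Borel sets already form one.\<close>

lemma sets_surface_base: "sets (surface_base :: 'a::euclidean_space measure) = sets borel"
proof -
  have "sets (surface_base :: 'a measure) = sigma_sets UNIV (sets borel)"
    unfolding surface_base_def by (rule sets_measure_of) simp
  also have "\<dots> = sets borel"
    using sets.sigma_sets_eq[of "borel :: 'a measure"] unfolding space_borel .
  finally show ?thesis .
qed

lemma closed_sets_surface:
  assumes "closed \<Gamma>"
  shows "\<Gamma> \<in> sets (completion surface_base)"
    and "\<Gamma> \<inter> space (completion surface_base) \<in> sets (completion surface_base)"
proof -
  have "\<Gamma> \<in> sets surface_base"
    unfolding sets_surface_base using assms by (rule borel_closed)
  then show "\<Gamma> \<in> sets (completion surface_base)"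
    by (rule sets_completionI_sets)
  then show "\<Gamma> \<inter> space (completion surface_base) \<in> sets (completion surface_base)"
    by (rule sets.Int) (rule sets.top)
qed

text \<open>The null sets of the restriction are the null sets of the completion that lie in
  \<open>\<Gamma>\<close>, so completeness is inherited.\<close>

lemma complete_measure_surface_on:
  assumes "closed \<Gamma>"
  shows "complete_measure (surface_on \<Gamma>)"
proof
  fix A B :: "'a set"
  assume BA: "B \<subseteq> A" and "A \<in> null_sets (surface_on \<Gamma>)"
  then have A: "A \<subseteq> \<Gamma>" "A \<in> null_sets (completion surface_base)"
    unfolding surface_on_eq by (simp_all add: null_sets_restrict_space[OF closed_sets_surface(1)[OF assms]])
  have "B \<in> null_sets (completion surface_base)"
    by (rule null_sets_completion_subset[OF BA A(2)])
  then have "B \<in> null_sets (surface_on \<Gamma>)"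
    unfolding surface_on_eq null_sets_restrict_space[OF closed_sets_surface(1)[OF assms]]
    using A(1) BA by simp
  then show "B \<in> sets (surface_on \<Gamma>)" by (rule null_setsD2)
qed

text \<open>Cauchy data are controlled on the whole boundary of an element, whereas
  \<open>dg_form\<close> integrates over interfaces and outer faces, which are closed pieces of
  it.\<close>

lemma AE_surface_on_subset:
  assumes "closed \<Gamma>" "closed \<Delta>" "\<Delta> \<subseteq> \<Gamma>" "AE x in surface_on \<Gamma>. R x"
  shows "AE x in surface_on \<Delta>. R x"
  using assms(3,4) unfolding surface_on_eq
    AE_restrict_space_iff[OF closed_sets_surface(2)[OF assms(1)]]
    AE_restrict_space_iff[OF closed_sets_surface(2)[OF assms(2)]]
  by (auto elim!: eventually_mono)

lemma square_integrable_surface_on_subset: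
  assumes "closed \<Gamma>" "closed \<Delta>" "\<Delta> \<subseteq> \<Gamma>" "square_integrable (surface_on \<Gamma>) f"
  shows "square_integrable (surface_on \<Delta>) f"
proof -
  have \<Delta>: "\<Delta> \<in> sets (surface_on \<Gamma>)"
    unfolding surface_on_eq sets_restrict_space
    by (rule image_eqI[OF _ closed_sets_surface(1)[OF assms(2)]]) (use assms(3) in blast)
  have eq: "surface_on \<Delta> = restrict_space (surface_on \<Gamma>) \<Delta>"
    unfolding surface_on_eq
    by (simp only: restrict_restrict_space[OF closed_sets_surface(2)[OF assms(1)] closed_sets_surface(2)[OF assms(2)]]
        Int_absorb1[OF assms(3)])
  have "integrable (surface_on \<Gamma>) (\<lambda>x. indicator \<Delta> x *\<^sub>R (cmod (f x))\<^sup>2)"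
    using assms(4) by (intro integrable_mult_indicator[OF \<Delta>]) (simp add: square_integrable_def)
  moreover have "\<Delta> \<inter> space (surface_on \<Gamma>) \<in> sets (surface_on \<Gamma>)"
    using \<Delta> by (rule sets.Int) (rule sets.top)
  ultimately show ?thesis
    using assms(4) unfolding eq square_integrable_def
    by (simp only: integrable_restrict_space measurable_restrict_space1 simp_thms)
qed

section \<open>Continuous multipliers on bounded open sets and the fundamental lemma of the calculus
  of variations\<close>

lemma finite_measure_lebesgue_on_open:
  assumes "open D" "bounded D"
  shows "finite_measure (lebesgue_on D)"
  by (intro finite_measure_lebesgue_on lmeasurable_open assms)

text \<open>A continuous \<open>h\<close> is bounded on the closure of \<open>D\<close>, which is
  compact because \<open>D\<close> is bounded.\<close>

lemma integrable_lebesgue_on_continuous_scaleR: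
  fixes h :: "'a::euclidean_space \<Rightarrow> real" and f :: "'a \<Rightarrow> complex"
  assumes D: "open D" "bounded D" and h: "continuous_on UNIV h" and f: "integrable (lebesgue_on D) f"
  shows "integrable (lebesgue_on D) (\<lambda>x. h x *\<^sub>R f x)"
proof -
  have "compact (h ` closure D)"
    using D h by (intro compact_continuous_image) (auto intro: continuous_on_subset)
  then obtain B where B: "\<And>x. x \<in> closure D \<Longrightarrow> \<bar>h x\<bar> \<le> B"
    using compact_imp_bounded by (fastforce simp: bounded_iff)
  have "h \<in> borel_measurable (lebesgue_on D)"
    using h D by (intro continuous_imp_measurable_on_sets_lebesgue) (auto intro: continuous_on_subset)
  then have meas: "(\<lambda>x. h x *\<^sub>R f x) \<in> borel_measurable (lebesgue_on D)"
    using borel_measurable_integrable[OF f] by (rule borel_measurable_scaleR)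
  have int: "integrable (lebesgue_on D) (\<lambda>x. B *\<^sub>R f x)"
    using f by simp
  show ?thesis
  proof (rule Bochner_Integration.integrable_bound[OF int meas], rule AE_I2)
    fix x assume "x \<in> space (lebesgue_on D)"
    then have "x \<in> closure D"
      by (simp add: subsetD[OF closure_subset])
    then have "\<bar>h x\<bar> \<le> \<bar>B\<bar>"
      using B[of x] by linarith
    then show "norm (h x *\<^sub>R f x) \<le> norm (B *\<^sub>R f x)"
      unfolding norm_scaleR by (rule mult_right_mono) simp
  qed
qed

lemma square_integrable_scaleR:
  assumes D: "open D" "bounded D" and f: "square_integrable (lebesgue_on D) f" and \<phi>: "C1_fun \<phi>"
  shows "integrable (lebesgue_on D) (\<lambda>x. \<phi> x *\<^sub>R f x)"
    and "b \<in> Basis \<Longrightarrow> integrable (lebesgue_on D) (\<lambda>x. partial_deriv b \<phi> x *\<^sub>R f x)"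
proof -
  have "integrable (lebesgue_on D) f"
    by (rule square_integrable_imp_integrable[OF finite_measure_lebesgue_on_open[OF D] f])
  note scaleR = integrable_lebesgue_on_continuous_scaleR[OF D _ this]
  show "integrable (lebesgue_on D) (\<lambda>x. \<phi> x *\<^sub>R f x)"
    by (rule scaleR[OF C1_fun_continuous_on[OF \<phi>]])
  show "integrable (lebesgue_on D) (\<lambda>x. partial_deriv b \<phi> x *\<^sub>R f x)" if "b \<in> Basis"
    using \<phi> that by (intro scaleR) (simp add: C1_fun_def)
qed

text \<open>\<open>lebesgue_on D\<close> is the restriction to \<open>D\<close> of the completion of
  \<open>lborel\<close>, so the separation lemma applies to the difference of the two
  functions.\<close>

lemma AE_eq_of_test_integrals:
  assumes D: "open D" "bounded D" and f: "square_integrable (lebesgue_on D) f"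
    and g: "square_integrable (lebesgue_on D) g"
    and eq: "\<And>\<phi>. test_fun D \<phi> \<Longrightarrow>
      (LINT x|lebesgue_on D. \<phi> x *\<^sub>R f x) = (LINT x|lebesgue_on D. \<phi> x *\<^sub>R g x)"
  shows "AE x in lebesgue_on D. f x = g x"
proof -
  let ?d = "\<lambda>x. f x - g x"
  have "AE x in lebesgue_on D. x \<in> D \<longrightarrow> ?d x = 0"
  proof (rule AE_zero_of_test_integrals)
    show "integrable (lebesgue_on D) ?d"
      using square_integrable_imp_integrable[OF finite_measure_lebesgue_on_open[OF D]] f g by auto
    show "(LINT x|lebesgue_on D. \<phi> x *\<^sub>R ?d x) = 0" if "test_fun D \<phi>" for \<phi>
    proof -
      have "C1_fun \<phi>" using that by (simp add: test_fun_def)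
      then show ?thesis
        using eq[OF that] square_integrable_scaleR(1)[OF D f] square_integrable_scaleR(1)[OF D g]
        by (simp add: scaleR_diff_right)
    qed
  qed (use D in auto)
  then show ?thesis
    using AE_space by eventually_elim auto
qed

section \<open>Weak derivatives and normal derivatives\<close>

lemma weak_gradient_unique:
  assumes D: "open D" "bounded D" and G: "weak_gradient D v G" and H: "weak_gradient D v H"
    and b: "b \<in> Basis"
  shows "AE x in lebesgue_on D. G b x = H b x"
proof (rule AE_eq_of_test_integrals[OF D])
  show "square_integrable (lebesgue_on D) (G b)" "square_integrable (lebesgue_on D) (H b)"
    using G H b by (auto simp: weak_gradient_def)
  show "(LINT x|lebesgue_on D. \<phi> x *\<^sub>R G b x) = (LINT x|lebesgue_on D. \<phi> x *\<^sub>R H b x)"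
    if "test_fun D \<phi>" for \<phi>
  proof -
    have "- (LINT x|lebesgue_on D. \<phi> x *\<^sub>R G b x) = - (LINT x|lebesgue_on D. \<phi> x *\<^sub>R H b x)"
      using G H b that unfolding weak_gradient_def by metis
    then show ?thesis by simp
  qed
qed

lemma weak_gradient_flux_integral:
  assumes D: "open D" "bounded D" and G: "weak_gradient D v G" and \<phi>: "C1_fun \<phi>"
  shows "integrable (lebesgue_on D) (\<lambda>x. \<Sum>b\<in>Basis. partial_deriv b \<phi> x *\<^sub>R G b x)"
    and "(LINT x|lebesgue_on D. (\<Sum>b\<in>Basis. partial_deriv b \<phi> x *\<^sub>R G b x)) =
      (\<Sum>b\<in>Basis. LINT x|lebesgue_on D. partial_deriv b \<phi> x *\<^sub>R G b x)"
proof -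
  have "integrable (lebesgue_on D) (\<lambda>x. partial_deriv b \<phi> x *\<^sub>R G b x)" if "b \<in> Basis" for b
    using that G by (intro square_integrable_scaleR(2)[OF D _ \<phi>]) (auto simp: weak_gradient_def)
  then show "integrable (lebesgue_on D) (\<lambda>x. \<Sum>b\<in>Basis. partial_deriv b \<phi> x *\<^sub>R G b x)"
    "(LINT x|lebesgue_on D. (\<Sum>b\<in>Basis. partial_deriv b \<phi> x *\<^sub>R G b x)) =
      (\<Sum>b\<in>Basis. LINT x|lebesgue_on D. partial_deriv b \<phi> x *\<^sub>R G b x)"
    by (auto intro: Bochner_Integration.integrable_sum Bochner_Integration.integral_sum)
qed

text \<open>Weak gradients occur in the definitions only under existential quantifiers. Their
  uniqueness makes the flux integral independent of the witness, also for C1 functions that do not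
  vanish near the boundary.\<close>

lemma weak_gradient_flux_unique:
  assumes D: "open D" "bounded D" and G: "weak_gradient D v G" and H: "weak_gradient D v H"
    and \<phi>: "C1_fun \<phi>"
  shows "(LINT x|lebesgue_on D. (\<Sum>b\<in>Basis. partial_deriv b \<phi> x *\<^sub>R G b x)) =
    (LINT x|lebesgue_on D. (\<Sum>b\<in>Basis. partial_deriv b \<phi> x *\<^sub>R H b x))"
proof -
  have "AE x in lebesgue_on D. \<forall>b\<in>Basis. G b x = H b x"
    using weak_gradient_unique[OF D G H] by (simp add: AE_finite_all)
  then have "AE x in lebesgue_on D. (\<Sum>b\<in>Basis. partial_deriv b \<phi> x *\<^sub>R G b x) =
      (\<Sum>b\<in>Basis. partial_deriv b \<phi> x *\<^sub>R H b x)"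
    by eventually_elim simp
  then show ?thesis
    using weak_gradient_flux_integral(1)[OF D G \<phi>] weak_gradient_flux_integral(1)[OF D H \<phi>]
    by (intro integral_cong_AE) auto
qed

text \<open>Both candidates are tested against flux integrals of the same \<open>v\<close>, which
  agree whichever gradient each definition supplies.\<close>

lemma weak_laplacian_unique:
  assumes D: "open D" "bounded D" and f: "weak_laplacian D v f" and g: "weak_laplacian D v g"
  shows "AE x in lebesgue_on D. f x = g x"
proof (rule AE_eq_of_test_integrals[OF D])
  show "square_integrable (lebesgue_on D) f" "square_integrable (lebesgue_on D) g"
    using f g by (auto simp: weak_laplacian_def)
  obtain G where G: "weak_gradient D v G" "\<And>\<phi>. test_fun D \<phi> \<Longrightarrow>
      (LINT x|lebesgue_on D. (\<Sum>b\<in>Basis. partial_deriv b \<phi> x *\<^sub>R G b x)) =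
      - (LINT x|lebesgue_on D. \<phi> x *\<^sub>R f x)"
    using f unfolding weak_laplacian_def by blast
  obtain H where H: "weak_gradient D v H" "\<And>\<phi>. test_fun D \<phi> \<Longrightarrow>
      (LINT x|lebesgue_on D. (\<Sum>b\<in>Basis. partial_deriv b \<phi> x *\<^sub>R H b x)) =
      - (LINT x|lebesgue_on D. \<phi> x *\<^sub>R g x)"
    using g unfolding weak_laplacian_def by blast
  show "(LINT x|lebesgue_on D. \<phi> x *\<^sub>R f x) = (LINT x|lebesgue_on D. \<phi> x *\<^sub>R g x)"
    if "test_fun D \<phi>" for \<phi>
    using weak_gradient_flux_unique[OF D G(1) H(1), of \<phi>] G(2)[OF that] H(2)[OF that] that
    by (simp add: test_fun_def)
qed

text \<open>The volume side of Green's formula does not depend on the chosen gradient and Laplacian,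
  so \<open>q\<close> and \<open>r\<close> have equal boundary integrals against all C1 functions,
  and these separate them.\<close>

lemma has_L2_normal_deriv_unique:
  assumes D: "open D" "bounded D" and q: "has_L2_normal_deriv D v q" and r: "has_L2_normal_deriv D v r"
  shows "AE x in surface_on (frontier D). q x = r x"
proof -
  let ?S = "surface_on (frontier D)"
  obtain G f where Gf: "weak_gradient D v G" "weak_laplacian D v f"
    and q': "\<And>\<phi>. C1_fun \<phi> \<Longrightarrow> has_bochner_integral ?S (\<lambda>x. \<phi> x *\<^sub>R q x)
      (LINT x|lebesgue_on D. (\<Sum>b\<in>Basis. partial_deriv b \<phi> x *\<^sub>R G b x) + \<phi> x *\<^sub>R f x)"
    using q unfolding has_L2_normal_deriv_def by blast
  obtain H g where Hg: "weak_gradient D v H" "weak_laplacian D v g"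
    and r': "\<And>\<phi>. C1_fun \<phi> \<Longrightarrow> has_bochner_integral ?S (\<lambda>x. \<phi> x *\<^sub>R r x)
      (LINT x|lebesgue_on D. (\<Sum>b\<in>Basis. partial_deriv b \<phi> x *\<^sub>R H b x) + \<phi> x *\<^sub>R g x)"
    using r unfolding has_L2_normal_deriv_def by blast
  have sq: "square_integrable (lebesgue_on D) f" "square_integrable (lebesgue_on D) g"
    using Gf Hg by (auto simp: weak_laplacian_def)
  have green: "(LINT x|lebesgue_on D. (\<Sum>b\<in>Basis. partial_deriv b \<phi> x *\<^sub>R G b x) + \<phi> x *\<^sub>R f x) =
    (LINT x|lebesgue_on D. (\<Sum>b\<in>Basis. partial_deriv b \<phi> x *\<^sub>R H b x) + \<phi> x *\<^sub>R g x)"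
    if \<phi>: "C1_fun \<phi>" for \<phi>
  proof -
    note int = weak_gradient_flux_integral(1)[OF D Gf(1) \<phi>] weak_gradient_flux_integral(1)[OF D Hg(1) \<phi>]
      square_integrable_scaleR(1)[OF D sq(1) \<phi>] square_integrable_scaleR(1)[OF D sq(2) \<phi>]
    have "(LINT x|lebesgue_on D. \<phi> x *\<^sub>R f x) = (LINT x|lebesgue_on D. \<phi> x *\<^sub>R g x)"
      using weak_laplacian_unique[OF D Gf(2) Hg(2)] int
      by (intro integral_cong_AE) (auto elim!: eventually_mono)
    then show ?thesis
      using weak_gradient_flux_unique[OF D Gf(1) Hg(1) \<phi>] int by simp
  qed
  \<comment> \<open>Testing Green's formula with the constant 1 yields integrability of the fluxes
    themselves.\<close>
  have int: "integrable ?S q" "integrable ?S r"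
    using q'[OF C1_fun_const[of 1]] r'[OF C1_fun_const[of 1]] by (auto simp: has_bochner_integral_iff)
  \<comment> \<open>The open set is \<open>UNIV\<close> so that the test functions see the frontier;
    those supported in the open set \<open>D\<close> vanish on it.\<close>
  have "AE x in ?S. x \<in> UNIV \<longrightarrow> q x - r x = 0"
    unfolding surface_on_eq
  proof (rule AE_zero_of_test_integrals[OF sets_surface_base])
    show "integrable (restrict_space (completion surface_base) (frontier D)) (\<lambda>x. q x - r x)"
      using int by (simp add: surface_on_eq)
    show "(LINT x|restrict_space (completion surface_base) (frontier D). \<phi> x *\<^sub>R (q x - r x)) = 0"
      if "test_fun UNIV \<phi>" for \<phi>
    proof -
      have \<phi>: "C1_fun \<phi>" using that by (simp add: test_fun_def)
      have "has_bochner_integral ?S (\<lambda>x. \<phi> x *\<^sub>R q x - \<phi> x *\<^sub>R r x) 0"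
        using has_bochner_integral_diff[OF q'[OF \<phi>] r'[OF \<phi>]] green[OF \<phi>] by simp
      then show ?thesis
        by (simp add: has_bochner_integral_iff scaleR_diff_right surface_on_eq)
    qed
  qed auto
  then show ?thesis by simp
qed

section \<open>Linearity of weak derivatives and normal derivatives\<close>

lemma integral_scaleR_lincomb:
  fixes f g :: "'a \<Rightarrow> complex"
  assumes "integrable M (\<lambda>x. h x *\<^sub>R f x)" "integrable M (\<lambda>x. h x *\<^sub>R g x)"
  shows "(LINT x|M. h x *\<^sub>R (a * f x + b * g x)) =
    a * (LINT x|M. h x *\<^sub>R f x) + b * (LINT x|M. h x *\<^sub>R g x)"
proof -
  have "(\<lambda>x. h x *\<^sub>R (a * f x + b * g x)) = (\<lambda>x. a * (h x *\<^sub>R f x) + b * (h x *\<^sub>R g x))"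
    by (simp add: scaleR_add_right)
  then show ?thesis
    using assms by (simp only: Bochner_Integration.integral_add integral_mult_right_zero
        Bochner_Integration.integrable_mult_right)
qed

lemma weak_gradient_lincomb:
  assumes D: "open D" "bounded D"
    and v: "square_integrable (lebesgue_on D) v" and w: "square_integrable (lebesgue_on D) w"
    and G: "weak_gradient D v G" and H: "weak_gradient D w H"
  shows "weak_gradient D (\<lambda>x. a * v x + c * w x) (\<lambda>b x. a * G b x + c * H b x)"
  unfolding weak_gradient_def
proof (intro ballI conjI allI impI)
  fix b :: 'a assume b: "b \<in> Basis"
  have sq: "square_integrable (lebesgue_on D) (G b)" "square_integrable (lebesgue_on D) (H b)"
    using G H b by (auto simp: weak_gradient_def)
  then show "square_integrable (lebesgue_on D) (\<lambda>x. a * G b x + c * H b x)"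
    by (rule square_integrable_lincomb)
  fix \<phi> assume t: "test_fun D \<phi>"
  then have \<phi>: "C1_fun \<phi>" by (simp add: test_fun_def)
  have parts: "(LINT x|lebesgue_on D. partial_deriv b \<phi> x *\<^sub>R v x) = - (LINT x|lebesgue_on D. \<phi> x *\<^sub>R G b x)"
    "(LINT x|lebesgue_on D. partial_deriv b \<phi> x *\<^sub>R w x) = - (LINT x|lebesgue_on D. \<phi> x *\<^sub>R H b x)"
    using G H b t by (auto simp: weak_gradient_def)
  show "(LINT x|lebesgue_on D. partial_deriv b \<phi> x *\<^sub>R (a * v x + c * w x)) =
      - (LINT x|lebesgue_on D. \<phi> x *\<^sub>R (a * G b x + c * H b x))"
    by (simp add: parts integral_scaleR_lincomb
        square_integrable_scaleR(1)[OF D sq(1) \<phi>] square_integrable_scaleR(1)[OF D sq(2) \<phi>]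
        square_integrable_scaleR(2)[OF D v \<phi> b] square_integrable_scaleR(2)[OF D w \<phi> b])
qed

lemma weak_gradient_flux_lincomb:
  assumes D: "open D" "bounded D" and \<phi>: "C1_fun \<phi>"
    and G: "weak_gradient D v G" and H: "weak_gradient D w H"
  shows "(LINT x|lebesgue_on D. (\<Sum>b\<in>Basis. partial_deriv b \<phi> x *\<^sub>R (a * G b x + c * H b x))) =
    a * (LINT x|lebesgue_on D. (\<Sum>b\<in>Basis. partial_deriv b \<phi> x *\<^sub>R G b x)) +
    c * (LINT x|lebesgue_on D. (\<Sum>b\<in>Basis. partial_deriv b \<phi> x *\<^sub>R H b x))"
proof -
  have "(\<Sum>b\<in>Basis. partial_deriv b \<phi> x *\<^sub>R (a * G b x + c * H b x)) =
    a * (\<Sum>b\<in>Basis. partial_deriv b \<phi> x *\<^sub>R G b x) + c * (\<Sum>b\<in>Basis. partial_deriv b \<phi> x *\<^sub>R H b x)" for x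
    by (simp add: sum_distrib_left sum.distrib[symmetric] scaleR_add_right)
  then show ?thesis
    using weak_gradient_flux_integral(1)[OF D G \<phi>] weak_gradient_flux_integral(1)[OF D H \<phi>] by simp
qed

lemma weak_laplacian_lincomb:
  assumes D: "open D" "bounded D"
    and v: "square_integrable (lebesgue_on D) v" and w: "square_integrable (lebesgue_on D) w"
    and f: "weak_laplacian D v f" and g: "weak_laplacian D w g"
  shows "weak_laplacian D (\<lambda>x. a * v x + c * w x) (\<lambda>x. a * f x + c * g x)"
proof -
  have sq: "square_integrable (lebesgue_on D) f" "square_integrable (lebesgue_on D) g"
    using f g by (auto simp: weak_laplacian_def)
  obtain G where G: "weak_gradient D v G" "\<And>\<phi>. test_fun D \<phi> \<Longrightarrow>
      (LINT x|lebesgue_on D. (\<Sum>b\<in>Basis. partial_deriv b \<phi> x *\<^sub>R G b x)) =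
      - (LINT x|lebesgue_on D. \<phi> x *\<^sub>R f x)"
    using f unfolding weak_laplacian_def by blast
  obtain H where H: "weak_gradient D w H" "\<And>\<phi>. test_fun D \<phi> \<Longrightarrow>
      (LINT x|lebesgue_on D. (\<Sum>b\<in>Basis. partial_deriv b \<phi> x *\<^sub>R H b x)) =
      - (LINT x|lebesgue_on D. \<phi> x *\<^sub>R g x)"
    using g unfolding weak_laplacian_def by blast
  show ?thesis
    unfolding weak_laplacian_def
  proof (intro conjI exI allI impI)
    show "square_integrable (lebesgue_on D) (\<lambda>x. a * f x + c * g x)"
      by (rule square_integrable_lincomb[OF sq])
    show "weak_gradient D (\<lambda>x. a * v x + c * w x) (\<lambda>b x. a * G b x + c * H b x)"
      by (rule weak_gradient_lincomb[OF D v w G(1) H(1)])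
    fix \<phi> assume t: "test_fun D \<phi>"
    then have \<phi>: "C1_fun \<phi>" by (simp add: test_fun_def)
    show "(LINT x|lebesgue_on D. (\<Sum>b\<in>Basis. partial_deriv b \<phi> x *\<^sub>R (a * G b x + c * H b x))) =
      - (LINT x|lebesgue_on D. \<phi> x *\<^sub>R (a * f x + c * g x))"
      by (simp add: weak_gradient_flux_lincomb[OF D \<phi> G(1) H(1)] G(2)[OF t] H(2)[OF t]
          integral_scaleR_lincomb square_integrable_scaleR(1)[OF D sq(1) \<phi>]
          square_integrable_scaleR(1)[OF D sq(2) \<phi>])
  qed
qed

text \<open>Green's formula is linear in volume data and boundary flux together, so combinations of
  the witnesses are witnesses for the combination.\<close>

lemma has_L2_normal_deriv_lincomb:
  fixes D :: "'a::euclidean_space set"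
  assumes D: "open D" "bounded D"
    and v: "square_integrable (lebesgue_on D) v" and w: "square_integrable (lebesgue_on D) w"
    and q: "has_L2_normal_deriv D v q" and r: "has_L2_normal_deriv D w r"
  shows "has_L2_normal_deriv D (\<lambda>x. a * v x + c * w x) (\<lambda>x. a * q x + c * r x)"
proof -
  let ?S = "surface_on (frontier D)"
  obtain G f where Gf: "weak_gradient D v G" "weak_laplacian D v f"
    and q': "\<And>\<phi>. C1_fun \<phi> \<Longrightarrow> has_bochner_integral ?S (\<lambda>x. \<phi> x *\<^sub>R q x)
      (LINT x|lebesgue_on D. (\<Sum>b\<in>Basis. partial_deriv b \<phi> x *\<^sub>R G b x) + \<phi> x *\<^sub>R f x)"
    using q unfolding has_L2_normal_deriv_def by blast
  obtain H g where Hg: "weak_gradient D w H" "weak_laplacian D w g"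
    and r': "\<And>\<phi>. C1_fun \<phi> \<Longrightarrow> has_bochner_integral ?S (\<lambda>x. \<phi> x *\<^sub>R r x)
      (LINT x|lebesgue_on D. (\<Sum>b\<in>Basis. partial_deriv b \<phi> x *\<^sub>R H b x) + \<phi> x *\<^sub>R g x)"
    using r unfolding has_L2_normal_deriv_def by blast
  have sq: "square_integrable (lebesgue_on D) f" "square_integrable (lebesgue_on D) g"
    using Gf Hg by (auto simp: weak_laplacian_def)
  show ?thesis
    unfolding has_L2_normal_deriv_def
  proof (intro conjI exI allI impI)
    show "square_integrable ?S (\<lambda>x. a * q x + c * r x)"
      using q r by (intro square_integrable_lincomb) (auto simp: has_L2_normal_deriv_def)
    show G: "weak_gradient D (\<lambda>x. a * v x + c * w x) (\<lambda>b x. a * G b x + c * H b x)"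
      by (rule weak_gradient_lincomb[OF D v w Gf(1) Hg(1)])
    show f: "weak_laplacian D (\<lambda>x. a * v x + c * w x) (\<lambda>x. a * f x + c * g x)"
      by (rule weak_laplacian_lincomb[OF D v w Gf(2) Hg(2)])
    fix \<phi> :: "'a \<Rightarrow> real" assume \<phi>: "C1_fun \<phi>"
    note int = weak_gradient_flux_integral(1)[OF D Gf(1) \<phi>] weak_gradient_flux_integral(1)[OF D Hg(1) \<phi>]
      weak_gradient_flux_integral(1)[OF D G \<phi>]
      square_integrable_scaleR(1)[OF D sq(1) \<phi>] square_integrable_scaleR(1)[OF D sq(2) \<phi>]
      square_integrable_scaleR(1)[OF D square_integrable_lincomb[OF sq] \<phi>]
    have "(LINT x|lebesgue_on D. (\<Sum>b\<in>Basis. partial_deriv b \<phi> x *\<^sub>R (a * G b x + c * H b x)) +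
        \<phi> x *\<^sub>R (a * f x + c * g x)) =
      a * (LINT x|lebesgue_on D. (\<Sum>b\<in>Basis. partial_deriv b \<phi> x *\<^sub>R G b x) + \<phi> x *\<^sub>R f x) +
      c * (LINT x|lebesgue_on D. (\<Sum>b\<in>Basis. partial_deriv b \<phi> x *\<^sub>R H b x) + \<phi> x *\<^sub>R g x)"
      unfolding Bochner_Integration.integral_add[OF int(3,6)] Bochner_Integration.integral_add[OF int(1,4)]
        Bochner_Integration.integral_add[OF int(2,5)] weak_gradient_flux_lincomb[OF D \<phi> Gf(1) Hg(1)]
        integral_scaleR_lincomb[OF int(4,5)]
      by (simp add: algebra_simps)
    moreover have "has_bochner_integral ?S (\<lambda>x. a * (\<phi> x *\<^sub>R q x) + c * (\<phi> x *\<^sub>R r x))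
      (a * (LINT x|lebesgue_on D. (\<Sum>b\<in>Basis. partial_deriv b \<phi> x *\<^sub>R G b x) + \<phi> x *\<^sub>R f x) +
       c * (LINT x|lebesgue_on D. (\<Sum>b\<in>Basis. partial_deriv b \<phi> x *\<^sub>R H b x) + \<phi> x *\<^sub>R g x))"
      by (intro has_bochner_integral_add has_bochner_integral_mult_right q'[OF \<phi>] r'[OF \<phi>])
    ultimately show "has_bochner_integral ?S (\<lambda>x. \<phi> x *\<^sub>R (a * q x + c * r x))
      (LINT x|lebesgue_on D. (\<Sum>b\<in>Basis. partial_deriv b \<phi> x *\<^sub>R (a * G b x + c * H b x)) +
        \<phi> x *\<^sub>R (a * f x + c * g x))"
      by (simp add: scaleR_add_right)
  qed
qed

lemma has_L2_normal_deriv_normal_deriv: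
  "has_L2_normal_deriv D v q \<Longrightarrow> has_L2_normal_deriv D v (normal_deriv D v)"
  unfolding normal_deriv_def by (rule someI[of "has_L2_normal_deriv D v"])

text \<open>\<open>normal_deriv\<close> chooses representatives independently for each function, so
  linearity comes from uniqueness and holds only up to surface-null sets.\<close>

lemma normal_deriv_lincomb:
  assumes D: "open D" "bounded D"
    and v: "square_integrable (lebesgue_on D) v" and w: "square_integrable (lebesgue_on D) w"
    and q: "\<exists>q. has_L2_normal_deriv D v q" and r: "\<exists>r. has_L2_normal_deriv D w r"
  shows "AE x in surface_on (frontier D). normal_deriv D (\<lambda>x. a * v x + c * w x) x =
    a * normal_deriv D v x + c * normal_deriv D w x"
proof -
  let ?u = "\<lambda>x. a * v x + c * w x"
  have "has_L2_normal_deriv D v (normal_deriv D v)" "has_L2_normal_deriv D w (normal_deriv D w)"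
    using q r has_L2_normal_deriv_normal_deriv by blast+
  then have lin: "has_L2_normal_deriv D ?u (\<lambda>x. a * normal_deriv D v x + c * normal_deriv D w x)"
    by (rule has_L2_normal_deriv_lincomb[OF D v w])
  then have "has_L2_normal_deriv D ?u (normal_deriv D ?u)"
    by (rule has_L2_normal_deriv_normal_deriv)
  then show ?thesis
    by (rule has_L2_normal_deriv_unique[OF D _ lin])
qed

section \<open>Boundary traces\<close>

text \<open>By the triangle inequality the mean oscillation of the combination is at most the
  weighted sum of those of \<open>v\<close> and \<open>w\<close>, which tend to 0.\<close>

lemma has_trace_at_lincomb:
  assumes D: "open D" "bounded D" and v: "integrable (lebesgue_on D) v" and w: "integrable (lebesgue_on D) w"
    and c: "has_trace_at D v x c" and e: "has_trace_at D w x e"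
  shows "has_trace_at D (\<lambda>y. a * v y + b * w y) x (a * c + b * e)"
proof -
  let ?A = "\<lambda>r. D \<inter> ball x r"
  let ?m = "\<lambda>r. measure lebesgue (?A r)"
  let ?I = "\<lambda>f s r. LINT y|lebesgue_on (?A r). cmod (f y - s)"
  have int: "integrable (lebesgue_on (?A r)) (\<lambda>y. cmod (f y - s))"
    if f: "integrable (lebesgue_on D) f" for f s r
  proof -
    have A: "open (?A r)" "bounded (?A r)"
      using D by (auto intro: bounded_subset)
    interpret finite_measure "lebesgue_on (?A r)"
      by (rule finite_measure_lebesgue_on_open[OF A])
    have "set_integrable lebesgue D f"
      using f D by (simp add: integrable_restrict_space set_integrable_def borel_open)
    then have "set_integrable lebesgue (?A r) f"
      using A by (rule_tac set_integrable_subset) (auto simp: borel_open)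
    then have "integrable (lebesgue_on (?A r)) f"
      using A by (simp add: integrable_restrict_space set_integrable_def borel_open)
    then show ?thesis
      by (intro integrable_norm Bochner_Integration.integrable_diff) simp_all
  qed
  \<comment> \<open>This holds for every real \<open>r\<close>: where the intersection has measure
    0, the quotients take the default value 0.\<close>
  have le: "?I (\<lambda>y. a * v y + b * w y) (a * c + b * e) r / ?m r
      \<le> cmod a * (?I v c r / ?m r) + cmod b * (?I w e r / ?m r)" for r
  proof -
    have "?I (\<lambda>y. a * v y + b * w y) (a * c + b * e) r
        \<le> (LINT y|lebesgue_on (?A r). cmod a * cmod (v y - c) + cmod b * cmod (w y - e))"
    proof (rule integral_mono)
      show "integrable (lebesgue_on (?A r)) (\<lambda>y. cmod (a * v y + b * w y - (a * c + b * e)))"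
        using v w by (intro int) simp
      show "integrable (lebesgue_on (?A r)) (\<lambda>y. cmod a * cmod (v y - c) + cmod b * cmod (w y - e))"
        using int[OF v] int[OF w] by simp
      fix y
      have "a * v y + b * w y - (a * c + b * e) = a * (v y - c) + b * (w y - e)"
        by (simp add: algebra_simps)
      then show "cmod (a * v y + b * w y - (a * c + b * e)) \<le> cmod a * cmod (v y - c) + cmod b * cmod (w y - e)"
        by (metis norm_mult norm_triangle_ineq)
    qed
    also have "\<dots> = cmod a * ?I v c r + cmod b * ?I w e r"
      using int[OF v] int[OF w] by simp
    finally show ?thesis
      by (simp add: divide_right_mono add_divide_distrib[symmetric])
  qed
  have lim: "((\<lambda>r. cmod a * (?I v c r / ?m r) + cmod b * (?I w e r / ?m r)) \<longlongrightarrow> cmod a * 0 + cmod b * 0) (at_right 0)"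
    using c e unfolding has_trace_at_def by (intro tendsto_intros)
  show ?thesis
    unfolding has_trace_at_def
  proof (rule tendsto_sandwich[OF always_eventually always_eventually tendsto_const])
    show "\<forall>r. 0 \<le> ?I (\<lambda>y. a * v y + b * w y) (a * c + b * e) r / ?m r"
      by simp
    show "\<forall>r. ?I (\<lambda>y. a * v y + b * w y) (a * c + b * e) r / ?m r
      \<le> cmod a * (?I v c r / ?m r) + cmod b * (?I w e r / ?m r)"
      using le by blast
    show "((\<lambda>r. cmod a * (?I v c r / ?m r) + cmod b * (?I w e r / ?m r)) \<longlongrightarrow> 0) (at_right 0)"
      using lim by simp
  qed
qed

text \<open>Subtraction gives the zero function the trace \<open>c - e\<close>, while the means
  involved are constantly \<open>cmod (c - e)\<close>. As \<open>x\<close> lies in the closure of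
  \<open>D\<close>, the set averaged over has positive measure for every positive radius.\<close>

lemma has_trace_at_unique:
  assumes D: "open D" "bounded D" and v: "integrable (lebesgue_on D) v" and x: "x \<in> closure D"
    and c: "has_trace_at D v x c" and e: "has_trace_at D v x e"
  shows "c = e"
proof -
  have "has_trace_at D (\<lambda>y. 1 * v y + (- 1) * v y) x (1 * c + (- 1) * e)"
    by (rule has_trace_at_lincomb[OF D v v c e])
  then have "((\<lambda>r. (LINT y|lebesgue_on (D \<inter> ball x r). cmod (c - e)) / measure lebesgue (D \<inter> ball x r))
      \<longlongrightarrow> 0) (at_right 0)"
    by (simp add: has_trace_at_def norm_minus_commute)
  moreover have "\<forall>\<^sub>F r in at_right 0. (LINT y|lebesgue_on (D \<inter> ball x r). cmod (c - e)) /
      measure lebesgue (D \<inter> ball x r) = cmod (c - e)"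
    unfolding eventually_at_right_field
  proof (intro exI[of _ 1] conjI allI impI)
    fix r :: real assume "0 < r"
    then have "ball x r \<inter> closure D \<noteq> {}"
      using x by (metis centre_in_ball disjoint_iff)
    then have "D \<inter> ball x r \<noteq> {}"
      using open_Int_closure_eq_empty[of "ball x r" D] by (simp add: Int_commute)
    moreover have A: "open (D \<inter> ball x r)" "bounded (D \<inter> ball x r)"
      using D by (auto intro: bounded_subset)
    ultimately have "\<not> negligible (D \<inter> ball x r)"
      using open_not_negligible by blast
    then have "measure lebesgue (D \<inter> ball x r) \<noteq> 0"
      using lmeasurable_open[OF A(2,1)] negligible_iff_measure by blast
    moreover have "measure (lebesgue_on (D \<inter> ball x r)) (D \<inter> ball x r) = measure lebesgue (D \<inter> ball x r)"
      using A by (simp add: measure_restrict_space borel_open)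
    ultimately show "(LINT y|lebesgue_on (D \<inter> ball x r). cmod (c - e)) /
        measure lebesgue (D \<inter> ball x r) = cmod (c - e)"
      by simp
  qed simp
  ultimately have "((\<lambda>r::real. cmod (c - e)) \<longlongrightarrow> 0) (at_right 0)"
    by (rule Lim_transform_eventually)
  then have "cmod (c - e) = 0"
    by (simp add: tendsto_const_iff)
  then show ?thesis by simp
qed

lemma has_trace_at_bdry_trace:
  assumes "open D" "bounded D" "integrable (lebesgue_on D) v" "x \<in> closure D" "has_trace_at D v x c"
  shows "bdry_trace D v x = c"
  unfolding bdry_trace_def using has_trace_at_unique[OF assms(1-4)] assms(5) by blast

text \<open>Uniqueness turns the definite description into the actual limit. Existence of the trace
  stays in the conclusion because \<open>has_L2_trace\<close> demands it too.\<close>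

lemma bdry_trace_lincomb:
  assumes D: "open D" "bounded D" and v: "integrable (lebesgue_on D) v" and w: "integrable (lebesgue_on D) w"
    and tr: "has_L2_trace D v" "has_L2_trace D w"
  shows "AE x in surface_on (frontier D).
      has_trace_at D (\<lambda>y. a * v y + b * w y) x (a * bdry_trace D v x + b * bdry_trace D w x) \<and>
      bdry_trace D (\<lambda>y. a * v y + b * w y) x = a * bdry_trace D v x + b * bdry_trace D w x"
proof -
  have vw: "integrable (lebesgue_on D) (\<lambda>y. a * v y + b * w y)"
    using v w by simp
  \<comment> \<open>The restricted measure lives on the frontier, which supplies the membership in
    \<open>closure D\<close> that uniqueness requires.\<close>
  have "AE x in surface_on (frontier D). x \<in> frontier D"
    unfolding surface_on_eq using AE_space by eventually_elim (simp add: space_restrict_space)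
  moreover have "AE x in surface_on (frontier D). \<exists>c. has_trace_at D v x c"
    "AE x in surface_on (frontier D). \<exists>c. has_trace_at D w x c"
    using tr by (auto simp: has_L2_trace_def)
  ultimately show ?thesis
  proof eventually_elim
    case (elim x)
    then have x: "x \<in> closure D" by (simp add: frontier_def)
    obtain c e where ce: "has_trace_at D v x c" "has_trace_at D w x e"
      using elim by blast
    have lin: "has_trace_at D (\<lambda>y. a * v y + b * w y) x (a * c + b * e)"
      by (rule has_trace_at_lincomb[OF D v w ce])
    show ?case
      using lin has_trace_at_bdry_trace[OF D vw x lin]
        has_trace_at_bdry_trace[OF D v x ce(1)] has_trace_at_bdry_trace[OF D w x ce(2)] by simp
  qed
qed

lemma has_L2_trace_lincomb:
  assumes D: "open D" "bounded D" and v: "integrable (lebesgue_on D) v" and w: "integrable (lebesgue_on D) w"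
    and tr: "has_L2_trace D v" "has_L2_trace D w"
  shows "has_L2_trace D (\<lambda>y. a * v y + b * w y)"
proof -
  interpret complete_measure "surface_on (frontier D)"
    by (rule complete_measure_surface_on) (rule frontier_closed)
  note ae = bdry_trace_lincomb[OF assms, of a b]
  have "square_integrable (surface_on (frontier D)) (\<lambda>x. a * bdry_trace D v x + b * bdry_trace D w x)"
    using tr by (intro square_integrable_lincomb) (simp_all add: has_L2_trace_def)
  \<comment> \<open>Completeness of the surface measure carries measurability over to the trace of
    the combination.\<close>
  then have "square_integrable (surface_on (frontier D)) (bdry_trace D (\<lambda>y. a * v y + b * w y))"
    by (rule square_integrable_cong_AE) (use ae in \<open>eventually_elim, simp\<close>)
  moreover have "AE x in surface_on (frontier D). \<exists>c. has_trace_at D (\<lambda>y. a * v y + b * w y) x c"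
    using ae by eventually_elim blast
  ultimately show ?thesis by (simp add: has_L2_trace_def)
qed

section \<open>Local solution spaces and their Cauchy data\<close>

lemma local_space_square_integrable: "v \<in> local_space \<omega> D \<Longrightarrow> square_integrable (lebesgue_on D) v"
  by (simp add: local_space_def H1_def)

lemma local_space_integrable:
  "open D \<Longrightarrow> bounded D \<Longrightarrow> v \<in> local_space \<omega> D \<Longrightarrow> integrable (lebesgue_on D) v"
  by (intro square_integrable_imp_integrable finite_measure_lebesgue_on_open local_space_square_integrable)

lemma local_space_lincomb:
  assumes D: "open D" "bounded D" and v: "v \<in> local_space \<omega> D" and w: "w \<in> local_space \<omega> D"
  shows "(\<lambda>x. a * v x + b * w x) \<in> local_space \<omega> D"
proof -
  note sq = local_space_square_integrable[OF v] local_space_square_integrable[OF w]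
  obtain G H where "weak_gradient D v G" "weak_gradient D w H"
    using v w by (auto simp: local_space_def H1_def)
  then have "weak_gradient D (\<lambda>x. a * v x + b * w x) (\<lambda>i x. a * G i x + b * H i x)"
    by (rule weak_gradient_lincomb[OF D sq])
  then have "(\<lambda>x. a * v x + b * w x) \<in> H1 D"
    unfolding H1_def using square_integrable_lincomb[OF sq] by blast
  moreover have "weak_laplacian D (\<lambda>x. a * v x + b * w x)
      (\<lambda>x. a * (- (complex_of_real \<omega>)\<^sup>2 * v x) + b * (- (complex_of_real \<omega>)\<^sup>2 * w x))"
    using v w by (intro weak_laplacian_lincomb[OF D sq]) (simp_all add: local_space_def)
  then have "weak_laplacian D (\<lambda>x. a * v x + b * w x)
      (\<lambda>x. - (complex_of_real \<omega>)\<^sup>2 * (a * v x + b * w x))"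
    by (simp add: algebra_simps)
  moreover have "has_L2_trace D (\<lambda>x. a * v x + b * w x)"
    using v w by (intro has_L2_trace_lincomb[OF D local_space_integrable[OF D v] local_space_integrable[OF D w]])
      (simp_all add: local_space_def)
  moreover obtain q r where "has_L2_normal_deriv D v q" "has_L2_normal_deriv D w r"
    using v w by (auto simp: local_space_def)
  then have "has_L2_normal_deriv D (\<lambda>x. a * v x + b * w x) (\<lambda>x. a * q x + b * r x)"
    by (rule has_L2_normal_deriv_lincomb[OF D sq])
  ultimately show ?thesis
    unfolding local_space_def by blast
qed

lemma local_space_cauchy_data_lincomb:
  assumes D: "open D" "bounded D" and v: "v \<in> local_space \<omega> D" and w: "w \<in> local_space \<omega> D"
    and \<Gamma>: "closed \<Gamma>" "\<Gamma> \<subseteq> frontier D"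
  shows "AE x in surface_on \<Gamma>.
      bdry_trace D (\<lambda>y. a * v y + b * w y) x = a * bdry_trace D v x + b * bdry_trace D w x \<and>
      normal_deriv D (\<lambda>y. a * v y + b * w y) x = a * normal_deriv D v x + b * normal_deriv D w x"
proof (rule AE_surface_on_subset[OF frontier_closed \<Gamma>])
  have "AE x in surface_on (frontier D).
      bdry_trace D (\<lambda>y. a * v y + b * w y) x = a * bdry_trace D v x + b * bdry_trace D w x"
    using bdry_trace_lincomb[OF D local_space_integrable[OF D v] local_space_integrable[OF D w], of a b] v w
    by (simp add: local_space_def)
  moreover have "AE x in surface_on (frontier D).
      normal_deriv D (\<lambda>y. a * v y + b * w y) x = a * normal_deriv D v x + b * normal_deriv D w x"
    using v w by (intro normal_deriv_lincomb[OF D] local_space_square_integrable) (auto simp: local_space_def)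
  ultimately show "AE x in surface_on (frontier D).
      bdry_trace D (\<lambda>y. a * v y + b * w y) x = a * bdry_trace D v x + b * bdry_trace D w x \<and>
      normal_deriv D (\<lambda>y. a * v y + b * w y) x = a * normal_deriv D v x + b * normal_deriv D w x"
    by eventually_elim simp
qed

lemma local_space_cauchy_data_square_integrable:
  assumes v: "v \<in> local_space \<omega> D" and \<Gamma>: "closed \<Gamma>" "\<Gamma> \<subseteq> frontier D"
  shows "square_integrable (surface_on \<Gamma>) (bdry_trace D v)"
    and "square_integrable (surface_on \<Gamma>) (normal_deriv D v)"
proof -
  show "square_integrable (surface_on \<Gamma>) (bdry_trace D v)"
    using v by (intro square_integrable_surface_on_subset[OF frontier_closed \<Gamma>])
      (simp add: local_space_def has_L2_trace_def)
  have "has_L2_normal_deriv D v (normal_deriv D v)"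
    using v has_L2_normal_deriv_normal_deriv by (auto simp: local_space_def)
  then show "square_integrable (surface_on \<Gamma>) (normal_deriv D v)"
    by (intro square_integrable_surface_on_subset[OF frontier_closed \<Gamma>])
      (simp add: has_L2_normal_deriv_def)
qed

section \<open>The discontinuous Galerkin form as a semi-inner product\<close>

lemma valid_dg_elem:
  assumes "valid_dg P" "k \<in> {1..num_elems P}"
  shows "open (elem P k)" "bounded (elem P k)"
  using assms by (auto simp: valid_dg_def partition_of_def polyhedral_domain_def)

lemma interface_closed: "closed (interface P k j)"
  by (simp add: interface_def closed_Int)

lemma interface_subset: "interface P k j \<subseteq> frontier (elem P k)" "interface P k j \<subseteq> frontier (elem P j)"
  by (auto simp: interface_def)

lemma outer_bdry_closed: "closed (outer_bdry P k)"
  by (simp add: outer_bdry_def closed_Int)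

text \<open>An element is an open subset of the closure of \<open>Dom P\<close>, hence of its
  interior, which is \<open>Dom P\<close> by the regularity condition in
  \<open>polyhedral_domain\<close>. So it misses the frontier of \<open>Dom P\<close>.\<close>

lemma outer_bdry_subset:
  assumes P: "valid_dg P" and k: "k \<in> {1..num_elems P}"
  shows "outer_bdry P k \<subseteq> frontier (elem P k)"
proof -
  have Dom: "open (Dom P)" "Dom P = interior (closure (Dom P))"
    using P by (auto simp: valid_dg_def polyhedral_domain_def)
  have "(\<Union>k\<in>{1..num_elems P}. closure (elem P k)) = closure (Dom P)"
    using P by (auto simp: valid_dg_def partition_of_def)
  then have "closure (elem P k) \<subseteq> closure (Dom P)"
    using k by blast
  then have "elem P k \<subseteq> closure (Dom P)"
    using closure_subset by (rule order_trans[rotated])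
  then have "elem P k \<subseteq> Dom P"
    using interior_maximal[OF _ valid_dg_elem(1)[OF P k]] Dom(2) by metis
  moreover have "frontier (Dom P) \<inter> Dom P = {}"
    using Dom(1) by (simp add: frontier_def interior_open Diff_Int_distrib2 Int_commute)
  ultimately have "outer_bdry P k \<subseteq> closure (elem P k) - elem P k"
    unfolding outer_bdry_def by blast
  then show ?thesis
    using valid_dg_elem(1)[OF P k] by (simp add: frontier_def interior_open)
qed

lemma V_space_lincomb:
  assumes "valid_dg P" "v \<in> V_space P" "w \<in> V_space P"
  shows "(\<lambda>x. a * v x + b * w x) \<in> V_space P"
  using assms unfolding V_space_def
  by (auto intro!: square_integrable_lincomb local_space_lincomb valid_dg_elem)

lemma V_space_elem: "v \<in> V_space P \<Longrightarrow> k \<in> {1..num_elems P} \<Longrightarrow> v \<in> local_space (wavenum P) (elem P k)"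
  by (simp add: V_space_def)

text \<open>Square integrability lets the integral split. Linearity is assumed almost everywhere
  only, which is what Cauchy data satisfy.\<close>

lemma integral_mult_cnj_lincomb:
  assumes f: "square_integrable M f" and g: "square_integrable M g" and h: "square_integrable M h"
    and F: "square_integrable M F" and ae: "AE x in M. F x = a * f x + b * g x"
  shows "(LINT x|M. F x * cnj (h x)) = a * (LINT x|M. f x * cnj (h x)) + b * (LINT x|M. g x * cnj (h x))"
proof -
  note int = square_integrable_mult_cnj[OF f h] square_integrable_mult_cnj[OF g h]
  have "(LINT x|M. F x * cnj (h x)) = (LINT x|M. a * (f x * cnj (h x)) + b * (g x * cnj (h x)))"
  proof (rule integral_cong_AE)
    show "(\<lambda>x. F x * cnj (h x)) \<in> borel_measurable M"
      by (rule borel_measurable_integrable[OF square_integrable_mult_cnj[OF F h]])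
    show "(\<lambda>x. a * (f x * cnj (h x)) + b * (g x * cnj (h x))) \<in> borel_measurable M"
      using int by (intro borel_measurable_integrable) simp
    show "AE x in M. F x * cnj (h x) = a * (f x * cnj (h x)) + b * (g x * cnj (h x))"
      using ae by eventually_elim (simp add: algebra_simps)
  qed
  also have "\<dots> = a * (LINT x|M. f x * cnj (h x)) + b * (LINT x|M. g x * cnj (h x))"
    using int by simp
  finally show ?thesis .
qed

lemma impedance_L2:
  assumes P: "valid_dg P" and k: "k \<in> {1..num_elems P}" and v: "v \<in> V_space P"
  shows "square_integrable (surface_on (outer_bdry P k)) (impedance P k v)"
proof -
  note sq = local_space_cauchy_data_square_integrable[OF V_space_elem[OF v k] outer_bdry_closed outer_bdry_subset[OF P k]]
  show ?thesis
    using square_integrable_lincomb[OF sq(2,1), of 1 "\<i> * complex_of_real (wavenum P)"]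
    by (simp add: impedance_def[abs_def])
qed

lemma impedance_lincomb:
  assumes P: "valid_dg P" and k: "k \<in> {1..num_elems P}" and v: "v \<in> V_space P" and w: "w \<in> V_space P"
  shows "AE x in surface_on (outer_bdry P k).
    impedance P k (\<lambda>y. a * v y + b * w y) x = a * impedance P k v x + b * impedance P k w x"
  using local_space_cauchy_data_lincomb[OF valid_dg_elem[OF P k] V_space_elem[OF v k] V_space_elem[OF w k]
      outer_bdry_closed outer_bdry_subset[OF P k], of a b]
  by eventually_elim (simp add: impedance_def algebra_simps)

lemma jumps_L2:
  assumes k: "k \<in> {1..num_elems P}" and j: "j \<in> {1..num_elems P}" and v: "v \<in> V_space P"
  shows "square_integrable (surface_on (interface P k j)) (value_jump P k j v)"
    and "square_integrable (surface_on (interface P k j)) (flux_jump P k j v)"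
proof -
  note sq = local_space_cauchy_data_square_integrable[OF V_space_elem[OF v k] interface_closed interface_subset(1)[of P k j]]
    local_space_cauchy_data_square_integrable[OF V_space_elem[OF v j] interface_closed interface_subset(2)[of P k j]]
  show "square_integrable (surface_on (interface P k j)) (value_jump P k j v)"
    using square_integrable_lincomb[OF sq(1,3), of 1 "- 1"] by (simp add: value_jump_def[abs_def])
  show "square_integrable (surface_on (interface P k j)) (flux_jump P k j v)"
    using square_integrable_lincomb[OF sq(2,4), of 1 1] by (simp add: flux_jump_def[abs_def])
qed

lemma jumps_lincomb:
  assumes P: "valid_dg P" and k: "k \<in> {1..num_elems P}" and j: "j \<in> {1..num_elems P}"
    and v: "v \<in> V_space P" and w: "w \<in> V_space P"
  shows "AE x in surface_on (interface P k j).
      value_jump P k j (\<lambda>y. a * v y + b * w y) x = a * value_jump P k j v x + b * value_jump P k j w x"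
    and "AE x in surface_on (interface P k j).
      flux_jump P k j (\<lambda>y. a * v y + b * w y) x = a * flux_jump P k j v x + b * flux_jump P k j w x"
proof -
  note lin = local_space_cauchy_data_lincomb[OF valid_dg_elem[OF P k] V_space_elem[OF v k] V_space_elem[OF w k]
      interface_closed interface_subset(1)[of P k j], where a = a and b = b]
    local_space_cauchy_data_lincomb[OF valid_dg_elem[OF P j] V_space_elem[OF v j] V_space_elem[OF w j]
      interface_closed interface_subset(2)[of P k j], where a = a and b = b]
  show "AE x in surface_on (interface P k j).
      value_jump P k j (\<lambda>y. a * v y + b * w y) x = a * value_jump P k j v x + b * value_jump P k j w x"
    using lin by eventually_elim (simp add: value_jump_def algebra_simps)
  show "AE x in surface_on (interface P k j).
      flux_jump P k j (\<lambda>y. a * v y + b * w y) x = a * flux_jump P k j v x + b * flux_jump P k j w x"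
    using lin by eventually_elim (simp add: flux_jump_def algebra_simps)
qed

lemma dg_form_lincomb_left:
  assumes P: "valid_dg P" and v: "v \<in> V_space P" and w: "w \<in> V_space P" and z: "z \<in> V_space P"
  shows "dg_form P (\<lambda>x. a * v x + b * w x) z = a * dg_form P v z + b * dg_form P w z"
proof -
  note vw = V_space_lincomb[OF P v w, of a b]
  have imp: "(LINT x|surface_on (outer_bdry P k). impedance P k (\<lambda>x. a * v x + b * w x) x * cnj (impedance P k z x)) =
      a * (LINT x|surface_on (outer_bdry P k). impedance P k v x * cnj (impedance P k z x)) +
      b * (LINT x|surface_on (outer_bdry P k). impedance P k w x * cnj (impedance P k z x))"
    if "k \<in> {1..num_elems P}" for k
    by (rule integral_mult_cnj_lincomb[OF impedance_L2[OF P that v] impedance_L2[OF P that w]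
          impedance_L2[OF P that z] impedance_L2[OF P that vw] impedance_lincomb[OF P that v w]])
  have jump: "(LINT x|surface_on (interface P k j). value_jump P k j (\<lambda>x. a * v x + b * w x) x * cnj (value_jump P k j z x)) =
      a * (LINT x|surface_on (interface P k j). value_jump P k j v x * cnj (value_jump P k j z x)) +
      b * (LINT x|surface_on (interface P k j). value_jump P k j w x * cnj (value_jump P k j z x))"
    "(LINT x|surface_on (interface P k j). flux_jump P k j (\<lambda>x. a * v x + b * w x) x * cnj (flux_jump P k j z x)) =
      a * (LINT x|surface_on (interface P k j). flux_jump P k j v x * cnj (flux_jump P k j z x)) +
      b * (LINT x|surface_on (interface P k j). flux_jump P k j w x * cnj (flux_jump P k j z x))"
    if "k \<in> {1..num_elems P}" "j \<in> {1..num_elems P}" for k j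
    by (rule integral_mult_cnj_lincomb[OF jumps_L2(1)[OF that v] jumps_L2(1)[OF that w]
          jumps_L2(1)[OF that z] jumps_L2(1)[OF that vw] jumps_lincomb(1)[OF P that v w]],
        rule integral_mult_cnj_lincomb[OF jumps_L2(2)[OF that v] jumps_L2(2)[OF that w]
          jumps_L2(2)[OF that z] jumps_L2(2)[OF that vw] jumps_lincomb(2)[OF P that v w]])
  show ?thesis
    unfolding dg_form_def sum_distrib_left sum.distrib[symmetric]
  proof (rule sum.cong[OF refl])
    fix k assume k: "k \<in> {1..num_elems P}"
    show "(LINT x|surface_on (outer_bdry P k). impedance P k (\<lambda>x. a * v x + b * w x) x * cnj (impedance P k z x)) +
        (\<Sum>j\<in>{1..num_elems P} - {k}.
           complex_of_real (jump_coeff P) *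
             (LINT x|surface_on (interface P k j). value_jump P k j (\<lambda>x. a * v x + b * w x) x * cnj (value_jump P k j z x)) +
           complex_of_real (flux_coeff P) *
             (LINT x|surface_on (interface P k j). flux_jump P k j (\<lambda>x. a * v x + b * w x) x * cnj (flux_jump P k j z x))) =
      a * ((LINT x|surface_on (outer_bdry P k). impedance P k v x * cnj (impedance P k z x)) +
        (\<Sum>j\<in>{1..num_elems P} - {k}.
           complex_of_real (jump_coeff P) *
             (LINT x|surface_on (interface P k j). value_jump P k j v x * cnj (value_jump P k j z x)) +
           complex_of_real (flux_coeff P) *
             (LINT x|surface_on (interface P k j). flux_jump P k j v x * cnj (flux_jump P k j z x)))) +
      b * ((LINT x|surface_on (outer_bdry P k). impedance P k w x * cnj (impedance P k z x)) +
        (\<Sum>j\<in>{1..num_elems P} - {k}.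
           complex_of_real (jump_coeff P) *
             (LINT x|surface_on (interface P k j). value_jump P k j w x * cnj (value_jump P k j z x)) +
           complex_of_real (flux_coeff P) *
             (LINT x|surface_on (interface P k j). flux_jump P k j w x * cnj (flux_jump P k j z x))))"
      using k by (simp add: imp jump distrib_left sum.distrib sum_distrib_left mult.left_commute)
  qed
qed

text \<open>Conjugation commutes with the integral and both parameters are real.\<close>

lemma dg_form_cnj:
  fixes P :: "'d::finite helmholtz_dg"
  shows "cnj (dg_form P v w) = dg_form P w v"
proof -
  have "cnj (LINT x|M. f x * cnj (g x)) = (LINT x|M. g x * cnj (f x))"
    for M :: "(real ^ 'd) measure" and f g
    using Bochner_Integration.integral_cnj[of M "\<lambda>x. f x * cnj (g x)"] by (simp add: mult.commute)
  then show ?thesis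
    unfolding dg_form_def by simp
qed

text \<open>On the diagonal every integrand is a squared modulus, and the parameters are
  positive.\<close>

lemma dg_form_self_nonneg:
  fixes P :: "'d::finite helmholtz_dg"
  assumes "valid_dg P"
  shows "Re (dg_form P v v) \<ge> 0"
proof -
  have "(LINT x|M. f x * cnj (f x)) = complex_of_real (LINT x|M. (cmod (f x))\<^sup>2)"
    for M :: "(real ^ 'd) measure" and f
    by (simp add: complex_norm_square[symmetric] flip: integral_complex_of_real)
  then show ?thesis
    using assms unfolding dg_form_def valid_dg_def by (auto intro!: sum_nonneg add_nonneg_nonneg)
qed

lemma Re_dg_form_commute: "Re (dg_form P v w) = Re (dg_form P w v)"
  by (metis complex_cnj dg_form_cnj complex.sel(1) complex_surj)

lemma dg_norm_square: "valid_dg P \<Longrightarrow> (dg_norm P v)\<^sup>2 = Re (dg_form P v v)"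
  by (simp add: dg_norm_def dg_form_self_nonneg)

text \<open>The real part of a Hermitian form is symmetric, so linearity moves over from the first
  argument; the scalars are real.\<close>

lemma Re_dg_form_lincomb_right:
  fixes s t :: real
  assumes P: "valid_dg P" and v: "v \<in> V_space P" and w: "w \<in> V_space P" and z: "z \<in> V_space P"
  shows "Re (dg_form P z (\<lambda>x. of_real s * v x + of_real t * w x)) =
    s * Re (dg_form P z v) + t * Re (dg_form P z w)"
  using dg_form_lincomb_left[OF P v w z, of "of_real s" "of_real t"]
  by (simp add: Re_dg_form_commute[of P z])

text \<open>The binomial formula of a real semi-inner product; the contraction argument combines
  functions with real scalars.\<close>

lemma dg_norm_square_lincomb:
  fixes s t :: real
  assumes P: "valid_dg P" and v: "v \<in> V_space P" and w: "w \<in> V_space P"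
  shows "(dg_norm P (\<lambda>x. of_real s * v x + of_real t * w x))\<^sup>2 =
    s\<^sup>2 * (dg_norm P v)\<^sup>2 + 2 * s * t * Re (dg_form P v w) + t\<^sup>2 * (dg_norm P w)\<^sup>2"
proof -
  let ?c = "\<lambda>x. of_real s * v x + of_real t * w x"
  have "Re (dg_form P ?c ?c) = s * Re (dg_form P v ?c) + t * Re (dg_form P w ?c)"
    using dg_form_lincomb_left[OF P v w V_space_lincomb[OF P v w]] by simp
  then show ?thesis
    using Re_dg_form_lincomb_right[OF P v w v, of s t] Re_dg_form_lincomb_right[OF P v w w, of s t]
    unfolding dg_norm_square[OF P]
    by (simp add: Re_dg_form_commute[of P w v] power2_eq_square algebra_simps)
qed

section \<open>Galerkin steps\<close>

text \<open>One pass of the recursion, from \<open>w\<close> to \<open>w'\<close>. The Galerkin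
  property enters through \<open>orth\<close>: the new error is orthogonal to the new direction and
  to the update.\<close>

lemma galerkin_step_contraction:
  assumes P: "valid_dg P" and u: "u \<in> V_space P" and w: "w \<in> V_space P"
    and w': "w' \<in> V_space P" and \<phi>: "\<phi> \<in> V_space P"
    and orth: "dg_form P (\<lambda>x. u x - w' x) \<phi> = 0" "dg_form P (\<lambda>x. u x - w' x) (\<lambda>x. w' x - w x) = 0"
    and \<phi>_norm: "dg_norm P \<phi> = 1" and \<epsilon>: "0 < \<epsilon>" "\<epsilon> < 1"
    and pos: "dg_norm P (\<lambda>x. u x - w x) > 0"
    and close: "dg_norm P (\<lambda>x. \<phi> x - (u x - w x) / complex_of_real (dg_norm P (\<lambda>y. u y - w y))) \<le> \<epsilon>"
  shows "dg_norm P (\<lambda>x. u x - w' x) < \<epsilon> * dg_norm P (\<lambda>x. u x - w x)"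
proof -
  have diff: "(\<lambda>x. f x - g x) \<in> V_space P" if "f \<in> V_space P" "g \<in> V_space P" for f g
    using V_space_lincomb[OF P that, of 1 "- 1"] by simp
  define e e' d where "e x = u x - w x" and "e' x = u x - w' x" and "d x = w' x - w x" for x
  define N where "N = dg_norm P e"
  define \<rho> where "\<rho> = Re (dg_form P e \<phi>)"
  \<comment> \<open>The gap between the Galerkin update \<open>d\<close> and the best real step
    along \<open>\<phi>\<close>. Being a combination of \<open>d\<close> and \<open>\<phi>\<close>,
    it is orthogonal to the new error \<open>e'\<close>.\<close>
  define c where "c x = d x - of_real \<rho> * \<phi> x" for x
  have V: "e \<in> V_space P" "e' \<in> V_space P" "d \<in> V_space P"
    unfolding e_def e'_def d_def by (intro diff u w w')+
  have c: "c = (\<lambda>x. of_real 1 * d x + of_real (- \<rho>) * \<phi> x)"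
    by (simp add: c_def fun_eq_iff)
  have cV: "c \<in> V_space P"
    unfolding c by (rule V_space_lincomb[OF P V(3) \<phi>])
  have N: "N > 0" using pos by (simp add: N_def e_def[abs_def])
  \<comment> \<open>Both \<open>\<phi>\<close> and \<open>e / N\<close> are unit vectors, so their distance controls \<open>\<rho> / N\<close> from below.\<close>
  have "(dg_norm P (\<lambda>x. \<phi> x - e x / complex_of_real N))\<^sup>2 = 2 - 2 * \<rho> / N"
    using dg_norm_square_lincomb[OF P \<phi> V(1), of 1 "- 1 / N"] N \<phi>_norm
    by (simp add: N_def[symmetric] Re_dg_form_commute[of P \<phi>] \<rho>_def[symmetric] power_divide)
  moreover have "(dg_norm P (\<lambda>x. \<phi> x - e x / complex_of_real N))\<^sup>2 \<le> \<epsilon>\<^sup>2"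
    using close unfolding N_def e_def[abs_def]
    by (intro power_mono) (auto simp: dg_norm_def dg_form_self_nonneg[OF P])
  ultimately have "2 - 2 * \<rho> / N \<le> \<epsilon>\<^sup>2" by simp
  then have \<rho>: "N * (1 - \<epsilon>\<^sup>2 / 2) \<le> \<rho>"
    using N by (simp add: field_simps)
  \<comment> \<open>This makes the lower bound for \<open>\<rho>\<close> nonnegative, so that it may
    be squared.\<close>
  have "\<epsilon>\<^sup>2 < 1" using \<epsilon> by (simp add: power_less_one_iff)
  then have "(N * (1 - \<epsilon>\<^sup>2 / 2))\<^sup>2 \<le> \<rho>\<^sup>2"
    using \<rho> N by (intro power_mono) auto
  \<comment> \<open>The last square on the right is the surplus that makes the contraction
    strict.\<close>
  moreover have "(N * (1 - \<epsilon>\<^sup>2 / 2))\<^sup>2 = N\<^sup>2 - (\<epsilon> * N)\<^sup>2 + (N * \<epsilon>\<^sup>2 / 2)\<^sup>2"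
    by (simp add: power2_eq_square field_simps)
  moreover have "(N * \<epsilon>\<^sup>2 / 2)\<^sup>2 > 0"
    using N \<epsilon> by simp
  ultimately have bound: "N\<^sup>2 - \<rho>\<^sup>2 < (\<epsilon> * N)\<^sup>2" by linarith
  \<comment> \<open>\<open>w + \<rho> \<phi>\<close> competes with the Galerkin solution \<open>w'\<close>; Pythagoras.\<close>
  have "(dg_norm P (\<lambda>x. e x - of_real \<rho> * \<phi> x))\<^sup>2 = N\<^sup>2 - \<rho>\<^sup>2"
    using dg_norm_square_lincomb[OF P V(1) \<phi>, of 1 "- \<rho>"] \<phi>_norm
    by (simp add: N_def[symmetric] \<rho>_def[symmetric] power2_eq_square)
  moreover have "(\<lambda>x. e x - of_real \<rho> * \<phi> x) = (\<lambda>x. e' x + c x)"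
    by (simp add: fun_eq_iff e_def e'_def d_def c_def)
  moreover have "Re (dg_form P e' c) = 0"
    using Re_dg_form_lincomb_right[OF P V(3) \<phi> V(2), of 1 "- \<rho>"] orth
    unfolding c by (simp add: e'_def[abs_def] d_def[abs_def])
  then have "(dg_norm P (\<lambda>x. e' x + c x))\<^sup>2 = (dg_norm P e')\<^sup>2 + (dg_norm P c)\<^sup>2"
    using dg_norm_square_lincomb[OF P V(2) cV, of 1 1] by simp
  ultimately have "(dg_norm P e')\<^sup>2 + (dg_norm P c)\<^sup>2 = N\<^sup>2 - \<rho>\<^sup>2"
    by simp
  then have "(dg_norm P e')\<^sup>2 < (\<epsilon> * N)\<^sup>2"
    using bound zero_le_power2[of "dg_norm P c"] by linarith
  then have "dg_norm P e' < \<epsilon> * N"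
    by (rule power2_less_imp_less) (use \<epsilon> N in simp)
  then show ?thesis
    by (simp add: N_def e_def[abs_def] e'_def[abs_def])
qed

section \<open>Complex spans of the directions\<close>

lemma complex_span_V_space:
  assumes P: "valid_dg P" and u: "u \<in> V_space P"
    and \<phi>: "\<And>m. m \<in> {1..j} \<Longrightarrow> \<phi> m \<in> V_space P" and v: "v \<in> complex_span \<phi> j"
  shows "v \<in> V_space P"
proof -
  \<comment> \<open>The empty sum needs the zero function, obtained here as a trivial combination of
    \<open>u\<close>.\<close>
  have zero: "(\<lambda>x. 0) \<in> V_space P"
    using V_space_lincomb[OF P u u, of 0 0] by simp
  have "(\<lambda>x. \<Sum>m\<in>M. c m * \<phi> m x) \<in> V_space P" if "finite M" "M \<subseteq> {1..j}" for M c
    using that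
  proof (induction M rule: finite_induct)
    case (insert m M)
    then show ?case
      using V_space_lincomb[OF P \<phi>[of m], of "\<lambda>x. \<Sum>m\<in>M. c m * \<phi> m x" "c m" 1] by simp
  qed (simp add: zero)
  then show ?thesis
    using v by (auto simp: complex_span_def)
qed

lemma complex_span_member: "j \<ge> 1 \<Longrightarrow> \<phi> j \<in> complex_span \<phi> j"
  unfolding complex_span_def
  by (auto intro!: exI[of _ "\<lambda>m. if m = j then 1 else 0"] simp: if_distrib[of "\<lambda>c. c * _"] cong: if_cong)

text \<open>Coefficients are padded with zeros. Nesting puts the previous iterate into the current
  span.\<close>

lemma complex_span_mono:
  assumes "i \<le> j"
  shows "complex_span \<phi> i \<subseteq> complex_span \<phi> j"
proof
  fix v assume "v \<in> complex_span \<phi> i"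
  then obtain c where v: "v = (\<lambda>x. \<Sum>m\<in>{1..i}. c m * \<phi> m x)"
    by (auto simp: complex_span_def)
  have "(\<Sum>m\<in>{1..i}. c m * \<phi> m x) = (\<Sum>m\<in>{1..j}. (if m \<le> i then c m else 0) * \<phi> m x)" for x
    using assms by (intro sum.mono_neutral_cong_left) auto
  with v show "v \<in> complex_span \<phi> j"
    unfolding complex_span_def by (auto intro!: exI[of _ "\<lambda>m. if m \<le> i then c m else 0"])
qed

lemma complex_span_diff:
  assumes "v \<in> complex_span \<phi> j" "w \<in> complex_span \<phi> j"
  shows "(\<lambda>x. v x - w x) \<in> complex_span \<phi> j"
proof -
  obtain c d where "v = (\<lambda>x. \<Sum>m\<in>{1..j}. c m * \<phi> m x)" "w = (\<lambda>x. \<Sum>m\<in>{1..j}. d m * \<phi> m x)"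
    using assms by (auto simp: complex_span_def)
  then have "(\<lambda>x. v x - w x) = (\<lambda>x. \<Sum>m\<in>{1..j}. (c m - d m) * \<phi> m x)"
    by (simp add: sum_subtractf left_diff_distrib)
  then show ?thesis
    unfolding complex_span_def by (auto intro!: exI[of _ "\<lambda>m. c m - d m"])
qed

section \<open>The product bound for the recursive procedure\<close>

theorem theorem4p1:
  fixes P :: "'d::finite helmholtz_dg"
    and u :: "real ^ 'd \<Rightarrow> complex"
    and U :: "nat \<Rightarrow> real ^ 'd \<Rightarrow> complex"
    and \<phi> :: "nat \<Rightarrow> real ^ 'd \<Rightarrow> complex"
    and \<epsilon> :: "nat \<Rightarrow> real"
    and n :: "nat \<Rightarrow> nat"
    and i :: nat
  assumes "valid_dg P"
    and "unique_solution P u"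
    and "i \<ge> 1"
    and "\<And>j. j \<in> {1..i} \<Longrightarrow> 0 < \<epsilon> j \<and> \<epsilon> j < 1"
    and "U 0 = (\<lambda>x. 0)"
    and "\<And>j. j \<in> {1..i} \<Longrightarrow> quasi_maximizer P u (U (j - 1)) (\<epsilon> j) (n j) (\<phi> j)"
    and "\<And>j. j \<in> {1..i} \<Longrightarrow> dg_norm P (\<phi> j) = 1"
    and "\<And>j. j \<in> {1..i} \<Longrightarrow> galerkin_solution P (complex_span \<phi> j) (U j)"
    and "\<And>j. j \<in> {1..i} \<Longrightarrow> dg_norm P (\<lambda>x. u x - U (j - 1) x) > 0"
    and "\<And>j. j \<in> {1..i} \<Longrightarrow>
           dg_norm P (\<lambda>x. \<phi> j x -
             (u x - U (j - 1) x) / complex_of_real (dg_norm P (\<lambda>y. u y - U (j - 1) y))) \<le> \<epsilon> j"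
  shows "dg_norm P (\<lambda>x. u x - U i x) < dg_norm P (\<lambda>x. u x - U 0 x) * (\<Prod>j\<in>{1..i}. \<epsilon> j)"
proof -
  note P = assms(1)
  have u: "u \<in> V_space P" and u_sol: "\<And>v. v \<in> V_space P \<Longrightarrow> dg_form P u v = dg_load P v"
    using assms(2) by (auto simp: unique_solution_def solves_dg_def)
  \<comment> \<open>A quasi-maximizer lies in \<open>dg_ball P\<close>, which is contained in
    \<open>V_space P\<close>.\<close>
  have \<phi>: "\<phi> j \<in> V_space P" if "j \<in> {1..i}" for j
    using assms(6)[OF that] by (simp add: quasi_maximizer_def dg_ball_def)
  have span_V: "v \<in> V_space P" if "v \<in> complex_span \<phi> j" "j \<le> i" for v j
    using that by (intro complex_span_V_space[OF P u _ that(1)] \<phi>) auto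
  \<comment> \<open>Index 0 is included, where the span consists of the zero function, because the
    first step refers to \<open>U 0\<close>.\<close>
  have U_span: "U j \<in> complex_span \<phi> j" if "j \<le> i" for j
  proof (cases "j = 0")
    case True
    then show ?thesis by (simp add: assms(5) complex_span_def)
  next
    case False
    with that assms(8)[of j] show ?thesis by (simp add: galerkin_solution_def)
  qed
  \<comment> \<open>Galerkin orthogonality: \<open>u\<close> and \<open>U j\<close> reproduce the
    same load on the span.\<close>
  have orth: "dg_form P (\<lambda>x. u x - U j x) v = 0" if j: "j \<in> {1..i}" and v: "v \<in> complex_span \<phi> j" for j v
  proof -
    have "v \<in> V_space P" "U j \<in> V_space P"
      using span_V[OF v] span_V[OF U_span] j by auto
    moreover have "dg_form P (U j) v = dg_load P v"
      using assms(8)[OF j] v by (simp add: galerkin_solution_def)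
    ultimately show ?thesis
      using dg_form_lincomb_left[OF P u, of "U j" v 1 "- 1"] u_sol by simp
  qed
  have step: "dg_norm P (\<lambda>x. u x - U j x) < \<epsilon> j * dg_norm P (\<lambda>x. u x - U (j - 1) x)"
    if j: "j \<in> {1..i}" for j
  proof -
    have span: "U (j - 1) \<in> complex_span \<phi> (j - 1)" "U j \<in> complex_span \<phi> j" "\<phi> j \<in> complex_span \<phi> j"
      using j by (auto intro!: U_span complex_span_member)
    \<comment> \<open>Both iterates lie in the current span, so their difference is an admissible
      test function.\<close>
    then have "U (j - 1) \<in> complex_span \<phi> j"
      using complex_span_mono[of "j - 1" j \<phi>] by auto
    then have d: "(\<lambda>x. U j x - U (j - 1) x) \<in> complex_span \<phi> j"
      by (rule complex_span_diff[OF span(2)])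
    have "U (j - 1) \<in> V_space P" "U j \<in> V_space P"
      using span_V[OF span(1)] span_V[OF span(2)] j by auto
    then show ?thesis
      using assms(4)[OF j] j
      by (intro galerkin_step_contraction[OF P u _ _ \<phi>[OF j] orth[OF j span(3)] orth[OF j d] assms(7)[OF j]
            _ _ assms(9)[OF j] assms(10)[OF j]]) auto
  qed
  \<comment> \<open>The induction starts at 1, since for \<open>m = 0\<close> the product is empty
    and both sides are equal.\<close>
  have "dg_norm P (\<lambda>x. u x - U m x) < dg_norm P (\<lambda>x. u x - U 0 x) * (\<Prod>j\<in>{1..m}. \<epsilon> j)"
    if "1 \<le> m" "m \<le> i" for m
    using that
  proof (induction m rule: nat_induct_at_least)
    case base
    then show ?case using step[of 1] by (simp add: mult.commute)
  next
    case (Suc m)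
    have "dg_norm P (\<lambda>x. u x - U (Suc m) x) < \<epsilon> (Suc m) * dg_norm P (\<lambda>x. u x - U m x)"
      using step[of "Suc m"] Suc.prems by simp
    also have "\<dots> < \<epsilon> (Suc m) * (dg_norm P (\<lambda>x. u x - U 0 x) * (\<Prod>j\<in>{1..m}. \<epsilon> j))"
      using Suc.IH Suc.prems assms(4)[of "Suc m"] by (intro mult_strict_left_mono) auto
    finally show ?case
      by (simp add: mult_ac prod.nat_ivl_Suc')
  qed
  then show ?thesis using assms(3) by blast
qed

end
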